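(* Let infinitely many observations $Y_i=F(u^\dagger)+\sigma\xi_i$, $i=1,2,\dots$, be given, put $Z_n=\frac1n\sum_{i=1}^nY_i$, and let the dynamic iteratively regularized Gauss–Newton iterates be $$\hat u_{n}:=\operatorname*{argmin}_{u\in\mathcal X}\Big[\mathcal S\big(F(\hat u_{n-1})+F'[\hat u_{n-1}](u-\hat u_{n-1});Z_n\big)+\alpha_n\|u-\hat u_0\|_{\mathcal X}^2\Big],\qquad n=1,2,\dots .$$ Let the variational source condition, the tangential cone condition and the $\mathcal V$-smoothing condition (see context) hold, suppose that $\|F(\hat u_0)-y^\dagger\|_{\mathcal Y}$ and $\eta$ are sufficiently small, and assume that all iterates $\hat u_n$ are well defined almost surely. (i) If $\alpha_n$ is chosen such that $\alpha_n\searrow0$ and $n\,\alpha_n^{2-\theta}\nearrow\infty$, then $\|\hat u_n-u^\dagger\|_{\mathcal X}^2\to0$ as $n\to\infty$, i.e. the method converges almost surely for infinitely many averaged observations. (ii) If additionally the saturation condition on $\varphi$ and the parameter condition on $(\alpha_n)$ (see context) hold and $\alpha_n$ is chosen such that $$\frac1{\alpha_n^{2-\theta}}\in\operatorname*{argmin}_{t>0}\Big[\Psi_\theta(t)+\frac{\sigma^2}{n}t\Big],$$ then $$\|\hat u_n-u^\dagger\|_{\mathcal X}^2=\mathcal O\Big(R_\theta\Big(\frac{\sigma^2}{n}\Big)\Big),\qquad R_\theta(s):=\inf_{t>0}\big[\Psi_\theta(t)+s\,t\big].$$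
   Context: Setting. $\mathcal X,\mathcal Y$ are Hilbert spaces, $F:D(F)\subset\mathcal X\to\mathcal Y$ is a nonlinear continuous operator with (Fréchet or other) derivative $F'[u]:\mathcal X\to\mathcal Y$ at $u$, $u^\dagger,\hat u_0\in D(F)$, $y^\dagger=F(u^\dagger)$, $\sigma>0$. Noise. $(\xi_n)$ are i.i.d. Hilbert space processes on $\mathcal Y$, i.e. bounded linear maps $\xi_n:\mathcal Y\to L^2(\Omega,\mathcal A,\mathbb P)$, $\langle\xi_n,g\rangle:=\xi_n(g)$, with $\mathbb E\xi_n=0$, $\|\mathrm{Cov}[\xi_n]\|_{\mathcal Y\to\mathcal Y}\le1$ and $\sum_{i=1}^n\xi_i\stackrel{\mathcal D}{=}\sqrt n\,\xi_1$. $(\mathcal V,\mathcal Y,\mathcal V')$ is a Gelfand triple with Hilbert–Schmidt embedding $\mathcal V\hookrightarrow\mathcal Y$, so that $\|\xi_n\|_{\mathcal V'}<\infty$ almost surely. The data are understood weakly. The noise contribution $\|\xi_1\|_{\mathcal V'}^2$ is handled as a (random) bounded constant, which enters the constant in $\mathcal O(\cdot)$. Data functional. $\mathcal S(g;W):=\frac12\|g\|_{\mathcal Y}^2-\langle g,W\rangle$ for $g\in\mathcal Y$. Conditions. (Variational source condition) There is a concave index function $\varphi$ (i.e. $\varphi(0)=0$, $\varphi$ monotonically increasing) such that for all $u\in D(F)$: $\|u-u^\dagger\|_{\mathcal X}^2\le\|u-\hat u_0\|_{\mathcal X}^2-\|u^\dagger-\hat u_0\|_{\mathcal X}^2+\varphi\big(\frac12\|F(u)-F(u^\dagger)\|_{\mathcal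 Y}^2\big)$. (Tangential cone condition) There are $C_{\mathrm{tc}}\ge1$ and $\eta>0$ sufficiently small with, for $u,v\in D(F)$: $\frac1{C_{\mathrm{tc}}}\|F(v)-y^\dagger\|_{\mathcal Y}^2-\eta\|F(u)-y^\dagger\|_{\mathcal Y}^2\le\|F(u)+F'[u](v-u)-y^\dagger\|_{\mathcal Y}^2\le C_{\mathrm{tc}}\|F(v)-y^\dagger\|_{\mathcal Y}^2+\eta\|F(u)-y^\dagger\|_{\mathcal Y}^2$. (Saturation) There is $\epsilon>0$ such that $\varphi^{1+\epsilon}$ is concave. (Parameter condition) $\alpha_0\le1$, $\alpha_n\searrow0$, $1\le\alpha_n/\alpha_{n+1}\le C_{\mathrm{dec}}$ for all $n\in\mathbb N$. ($\mathcal V$-smoothing) There are $\theta\in(0,1)$, $C_\theta\ge1$ such that for the iterates $\hat u_n$ and all $u\in\mathcal X$: $\|F'[\hat u_n](u-u^\dagger)\|_{\mathcal V}\le C_\theta\|F'[\hat u_n](u-u^\dagger)\|_{\mathcal Y}^\theta\|u-u^\dagger\|_{\mathcal X}^{1-\theta}$. Notation. $\Psi_\theta(t):=(-\varphi)^*(-t^{1/(2-\theta)})=\sup_{\tau\ge0}\big[\varphi(\tau)-t^{1/(2-\theta)}\tau\big]$ for $t>0$, where $^*$ is the Fenchel conjugate.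
   Formalization: The index function φ is additionally assumed continuous, which for a concave increasing φ only excludes a jump at 0; with such a jump the convergence claim (i) fails. *)

theory Defs
  imports "HOL-Probability.Probability" "HOL-Library.Landau_Symbols"
begin

definition orthonormal_basis :: "'a::real_inner set \<Rightarrow> bool" where
  "orthonormal_basis E \<longleftrightarrow>
     pairwise orthogonal E \<and> (\<forall>e\<in>E. norm e = 1) \<and> closure (span E) = UNIV"

definition hilbert_schmidt :: "('a::real_inner \<Rightarrow> 'b::real_normed_vector) \<Rightarrow> bool" where
  "hilbert_schmidt T \<longleftrightarrow> bounded_linear T \<and>
     (\<exists>E. orthonormal_basis E \<and> (\<lambda>e. (norm (T e))\<^sup>2) summable_on E)"

text \<open>The smaller space \<open>V\<close> of the triple \<open>(V, Y, V')\<close> is a type of its own; \<open>j\<close> is the dense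
  embedding of \<open>V\<close> into the pivot space \<open>Y\<close>.  A linear functional \<open>w\<close> on \<open>Y\<close> has finite
  \<open>V'\<close>-norm iff \<open>\<lambda>v. w (j v)\<close> is bounded linear.\<close>

definition gelfand_embedding :: "('v::real_inner \<Rightarrow> 'y::real_inner) \<Rightarrow> bool" where
  "gelfand_embedding j \<longleftrightarrow> bounded_linear j \<and> inj j \<and> closure (range j) = UNIV"

text \<open>A process \<open>X\<close> is given by representatives: \<open>X g \<omega>\<close> is the value at \<open>\<omega>\<close> of the pairing of
  \<open>X\<close> with \<open>g\<close>.  As a map into \<open>L\<^sup>2\<close> it is linear up to null sets depending on the arguments.\<close>

definition hilbert_space_process :: "'w measure \<Rightarrow> ('y::real_inner \<Rightarrow> 'w \<Rightarrow> real) \<Rightarrow> bool" where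
  "hilbert_space_process M X \<longleftrightarrow>
     (\<forall>g. X g \<in> borel_measurable M \<and> integrable M (\<lambda>\<omega>. (X g \<omega>)\<^sup>2)) \<and>
     (\<forall>a b g h. AE \<omega> in M. X (a *\<^sub>R g + b *\<^sub>R h) \<omega> = a * X g \<omega> + b * X h \<omega>) \<and>
     (\<exists>C. \<forall>g. sqrt (\<integral>\<omega>. (X g \<omega>)\<^sup>2 \<partial>M) \<le> C * norm g)"

definition centered_process :: "'w measure \<Rightarrow> ('y \<Rightarrow> 'w \<Rightarrow> real) \<Rightarrow> bool" where
  "centered_process M X \<longleftrightarrow> (\<forall>g. (\<integral>\<omega>. X g \<omega> \<partial>M) = 0)"

definition covariance_operator ::
    "'w measure \<Rightarrow> ('y::real_inner \<Rightarrow> 'w \<Rightarrow> real) \<Rightarrow> ('y \<Rightarrow> 'y) \<Rightarrow> bool" where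
  "covariance_operator M X K \<longleftrightarrow> bounded_linear K \<and>
     (\<forall>g h. inner (K g) h =
        (\<integral>\<omega>. (X g \<omega> - (\<integral>\<omega>'. X g \<omega>' \<partial>M)) * (X h \<omega> - (\<integral>\<omega>'. X h \<omega>' \<partial>M)) \<partial>M))"

text \<open>The law on the cylinder \<open>\<sigma>\<close>-algebra, i.e. the family of finite-dimensional distributions.\<close>

definition process_law :: "'w measure \<Rightarrow> ('y \<Rightarrow> 'w \<Rightarrow> real) \<Rightarrow> ('y \<Rightarrow> real) measure" where
  "process_law M X = distr M (PiM UNIV (\<lambda>_. borel)) (\<lambda>\<omega> g. X g \<omega>)"

text \<open>Index \<open>0\<close> is not used: the noise processes are \<open>\<xi> 1, \<xi> 2, \<dots>\<close>.\<close>

definition iid_processes :: "'w measure \<Rightarrow> (nat \<Rightarrow> 'y \<Rightarrow> 'w \<Rightarrow> real) \<Rightarrow> bool" where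
  "iid_processes M \<xi> \<longleftrightarrow>
     prob_space.indep_vars M (\<lambda>_. PiM UNIV (\<lambda>_. borel)) (\<lambda>i \<omega> g. \<xi> i g \<omega>) {1..} \<and>
     (\<forall>i\<ge>1. process_law M (\<xi> i) = process_law M (\<xi> 1))"

text \<open>The last clause says that almost surely the realisation of \<open>\<xi> i\<close> is linear and lies in \<open>V'\<close>.
  It only fixes the representatives: since the embedding is Hilbert--Schmidt, a process has a
  version whose realisations belong to \<open>V'\<close>, and these can be extended linearly from the range of
  \<open>j\<close> to \<open>Y\<close> along an algebraic complement, using arbitrary representatives on a basis of it.\<close>

definition noise_sequence ::
    "'w measure \<Rightarrow> ('v::real_inner \<Rightarrow> 'y::real_inner) \<Rightarrow> (nat \<Rightarrow> 'y \<Rightarrow> 'w \<Rightarrow> real) \<Rightarrow> bool" where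
  "noise_sequence M j \<xi> \<longleftrightarrow>
     (\<forall>i\<ge>1. hilbert_space_process M (\<xi> i) \<and> centered_process M (\<xi> i) \<and>
        (\<exists>K. covariance_operator M (\<xi> i) K \<and> onorm K \<le> 1)) \<and>
     iid_processes M \<xi> \<and>
     (\<forall>n\<ge>1. process_law M (\<lambda>g \<omega>. \<Sum>i=1..n. \<xi> i g \<omega>)
            = process_law M (\<lambda>g \<omega>. sqrt (real n) * \<xi> 1 g \<omega>)) \<and>
     (\<forall>i\<ge>1. AE \<omega> in M. linear (\<lambda>g. \<xi> i g \<omega>) \<and> bounded_linear (\<lambda>v. \<xi> i (j v) \<omega>))"

text \<open>Data are understood weakly, as functionals \<open>g \<mapsto> \<langle>g, W\<rangle>\<close> on \<open>Y\<close>.\<close>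

definition data_functional :: "'y::real_inner \<Rightarrow> ('y \<Rightarrow> real) \<Rightarrow> real" where
  "data_functional g W = (norm g)\<^sup>2 / 2 - W g"

definition observation ::
    "'y::real_inner \<Rightarrow> real \<Rightarrow> ('y \<Rightarrow> 'w \<Rightarrow> real) \<Rightarrow> 'w \<Rightarrow> 'y \<Rightarrow> real" where
  "observation y \<sigma> X \<omega> = (\<lambda>g. inner y g + \<sigma> * X g \<omega>)"

definition averaged_data ::
    "'y::real_inner \<Rightarrow> real \<Rightarrow> (nat \<Rightarrow> 'y \<Rightarrow> 'w \<Rightarrow> real) \<Rightarrow> 'w \<Rightarrow> nat \<Rightarrow> 'y \<Rightarrow> real" where
  "averaged_data y \<sigma> \<xi> \<omega> n = (\<lambda>g. (\<Sum>i=1..n. observation y \<sigma> (\<xi> i) \<omega> g) / real n)"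

text \<open>Well-definedness of the iterates includes that they stay in the domain \<open>D\<close> of \<open>F\<close>; the
  minimisation itself is over the whole space.\<close>

definition dynamic_irgn_iterates ::
    "'x::real_inner set \<Rightarrow> ('x \<Rightarrow> 'y::real_inner) \<Rightarrow> ('x \<Rightarrow> 'x \<Rightarrow> 'y) \<Rightarrow> 'x \<Rightarrow>
     (nat \<Rightarrow> 'y \<Rightarrow> real) \<Rightarrow> (nat \<Rightarrow> real) \<Rightarrow> (nat \<Rightarrow> 'x) \<Rightarrow> bool" where
  "dynamic_irgn_iterates D F F' u\<^sub>0 Z \<alpha> x \<longleftrightarrow> x 0 = u\<^sub>0 \<and>
     (\<forall>n\<ge>1. x n \<in> D \<and>
        is_arg_min
          (\<lambda>u. data_functional (F (x (n - 1)) + F' (x (n - 1)) (u - x (n - 1))) (Z n)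
               + \<alpha> n * (norm (u - u\<^sub>0))\<^sup>2)
          (\<lambda>u. u \<in> UNIV) (x n))"

text \<open>The kind of derivative is left open in the setting.  Required is only the weakest common
  property: \<open>F' u\<close> is bounded linear and gives the one-sided directional derivatives along those
  directions which stay in the domain.  Frechet and Gateaux derivatives satisfy this.\<close>

definition derivative_on ::
    "'x::real_normed_vector set \<Rightarrow> ('x \<Rightarrow> 'y::real_normed_vector) \<Rightarrow> ('x \<Rightarrow> 'x \<Rightarrow> 'y) \<Rightarrow> bool" where
  "derivative_on D F F' \<longleftrightarrow>
     (\<forall>u\<in>D. bounded_linear (F' u) \<and>
        (\<forall>h. (\<forall>\<^sub>F t in at_right 0. u + t *\<^sub>R h \<in> D) \<longrightarrow>
           ((\<lambda>t. (F (u + t *\<^sub>R h) - F u) /\<^sub>R t) \<longlongrightarrow> F' u h) (at_right 0)))"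

text \<open>Index functions are continuous, as usual; for concave monotone functions this
  only excludes a jump at \<open>0\<close>.  Values at negative arguments are irrelevant.\<close>

definition index_function :: "(real \<Rightarrow> real) \<Rightarrow> bool" where
  "index_function \<phi> \<longleftrightarrow> \<phi> 0 = 0 \<and> mono_on {0..} \<phi> \<and> continuous_on {0..} \<phi>"

definition variational_source_condition ::
    "'x::real_normed_vector set \<Rightarrow> ('x \<Rightarrow> 'y::real_normed_vector) \<Rightarrow> 'x \<Rightarrow> 'x \<Rightarrow> (real \<Rightarrow> real) \<Rightarrow> bool"
  where
  "variational_source_condition D F u\<^sub>d u\<^sub>0 \<phi> \<longleftrightarrow>
     (\<forall>u\<in>D. (norm (u - u\<^sub>d))\<^sup>2 \<le>
        (norm (u - u\<^sub>0))\<^sup>2 - (norm (u\<^sub>d - u\<^sub>0))\<^sup>2 + \<phi> ((norm (F u - F u\<^sub>d))\<^sup>2 / 2))"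

definition tangential_cone_condition ::
    "'x::real_normed_vector set \<Rightarrow> ('x \<Rightarrow> 'y::real_normed_vector) \<Rightarrow> ('x \<Rightarrow> 'x \<Rightarrow> 'y) \<Rightarrow> 'y \<Rightarrow>
     real \<Rightarrow> real \<Rightarrow> bool" where
  "tangential_cone_condition D F F' y C \<eta> \<longleftrightarrow>
     (\<forall>u\<in>D. \<forall>v\<in>D.
        1 / C * (norm (F v - y))\<^sup>2 - \<eta> * (norm (F u - y))\<^sup>2
          \<le> (norm (F u + F' u (v - u) - y))\<^sup>2 \<and>
        (norm (F u + F' u (v - u) - y))\<^sup>2
          \<le> C * (norm (F v - y))\<^sup>2 + \<eta> * (norm (F u - y))\<^sup>2)"

text \<open>Elements of \<open>Y\<close> have a \<open>V\<close>-norm only if they lie in the range of \<open>j\<close>, which is part of the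
  condition.\<close>

definition V_smoothing ::
    "('v::real_inner \<Rightarrow> 'y::real_inner) \<Rightarrow> ('x::real_normed_vector \<Rightarrow> 'x \<Rightarrow> 'y) \<Rightarrow> 'x \<Rightarrow> real \<Rightarrow> real \<Rightarrow>
     (nat \<Rightarrow> 'x) \<Rightarrow> bool" where
  "V_smoothing j F' u\<^sub>d \<theta> C x \<longleftrightarrow>
     (\<forall>n u. F' (x n) (u - u\<^sub>d) \<in> range j \<and>
        norm (inv j (F' (x n) (u - u\<^sub>d)))
          \<le> C * norm (F' (x n) (u - u\<^sub>d)) powr \<theta> * norm (u - u\<^sub>d) powr (1 - \<theta>))"

definition saturation_condition :: "(real \<Rightarrow> real) \<Rightarrow> bool" where
  "saturation_condition \<phi> \<longleftrightarrow> (\<exists>\<epsilon>>0. concave_on {0..} (\<lambda>\<tau>. \<phi> \<tau> powr (1 + \<epsilon>)))"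

definition parameter_condition :: "real \<Rightarrow> (nat \<Rightarrow> real) \<Rightarrow> bool" where
  "parameter_condition C \<alpha> \<longleftrightarrow> \<alpha> 0 \<le> 1 \<and> decseq \<alpha> \<and> \<alpha> \<longlonglongrightarrow> 0 \<and>
     (\<forall>n. 1 \<le> \<alpha> n / \<alpha> (Suc n) \<and> \<alpha> n / \<alpha> (Suc n) \<le> C)"

text \<open>Fenchel conjugate of a function with effective domain \<open>A\<close> (value \<open>\<infinity>\<close> outside \<open>A\<close>).\<close>

definition fenchel_conjugate :: "real set \<Rightarrow> (real \<Rightarrow> real) \<Rightarrow> real \<Rightarrow> real" where
  "fenchel_conjugate A f s = (SUP \<tau>\<in>A. s * \<tau> - f \<tau>)"

text \<open>Under the saturation condition \<open>\<phi>\<close> grows sublinearly, so for \<open>t > 0\<close> the supremum below is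
  over a bounded set; since \<open>\<phi> 0 = 0\<close>, it is nonnegative, so the infimum in \<open>R_rate\<close> is over a set
  bounded below.  Both are used only under that condition.\<close>

definition Psi :: "real \<Rightarrow> (real \<Rightarrow> real) \<Rightarrow> real \<Rightarrow> real" where
  "Psi \<theta> \<phi> t = fenchel_conjugate {0..} (\<lambda>\<tau>. - \<phi> \<tau>) (- (t powr (1 / (2 - \<theta>))))"

definition R_rate :: "real \<Rightarrow> (real \<Rightarrow> real) \<Rightarrow> real \<Rightarrow> real" where
  "R_rate \<theta> \<phi> s = (INF t\<in>{0<..}. Psi \<theta> \<phi> t + s * t)"

end

theory Submission
  imports Defs
begin

text \<open>
  Comparing the Tikhonov functional at \<open>u n\<close> and at the exact solution, the source and tangential
  cone conditions give, with \<open>e = norm (u n - u\<^sub>d)\<close> and \<open>d n = norm (F (u n) - F u\<^sub>d)\<close>,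
  \<open>\<alpha> e\<^sup>2 + d n\<^sup>2 / (2 C) \<le> \<eta> d (n - 1)\<^sup>2 + \<alpha> \<phi> (d n\<^sup>2 / 2) + noise\<close>.
  The Fenchel conjugate absorbs \<open>\<phi>\<close>, smoothing and Young's inequality absorb the noise, and what
  remains is a contraction for \<open>d n\<^sup>2 / \<alpha> n\<close>.

  Almost sure bounds for all \<open>n\<close> cannot rest on the dual norm of \<open>S n / sqrt n\<close> on \<open>V\<close>, where \<open>S n\<close>
  is the sum of the first \<open>n\<close> noise processes: by the law of the iterated logarithm it is unbounded.
  However, the noise is Gaussian, and along a singular value decomposition of the embedding an
  exponential moment bound yields, almost surely and up to a random factor,
  \<open>\<bar>S n (j v)\<bar> \<le> sqrt n (norm v + sqrt (ln (n + 1)) norm (j v))\<close>.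
  The logarithmic part costs only \<open>ln (n + 1) / (n \<alpha> n)\<close>, which is of lower order than
  \<open>1 / (n \<alpha> n powr (2 - \<theta>))\<close> if \<open>\<alpha> n\<close> decays polynomially, and is otherwise dominated by \<open>\<Psi>\<close>.
\<close>

subsection \<open>Exponential moments of subgaussian square sums\<close>

text \<open>The variance of \<open>S n (j v) / sqrt n\<close> is at most
  \<open>(norm (j v))\<^sup>2\<close>, while finiteness of the trace keeps the typical size of the
  functional on the unit ball of V bounded. A deviation of level \<open>r\<close> therefore has to
  be paid for only in the weaker norm: outside an event of probability
  \<open>exp (- (r\<^sup>2 / 2))\<close> the squared functional is at most a constant times
  \<open>(norm v)\<^sup>2 + r\<^sup>2 * (norm (j v))\<^sup>2\<close>. With
  \<open>r = 2 * sqrt (ln (n + 1))\<close> these probabilities are summable in \<open>n\<close>. In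
  the step estimate the part with \<open>norm (j v)\<close> is absorbed by the residual alone,
  without the smoothing interpolation, and so produces no negative power of
  \<open>\<alpha> n\<close>. After division by \<open>\<alpha> n\<close> the contraction factor is
  \<open>16 * C * \<eta> * r\<close>, where \<open>r\<close> bounds
  \<open>\<alpha> (n - 1) / \<alpha> n\<close>. The bound \<open>1 / (64 * C * Cd)\<close> for
  \<open>\<eta>\<close> makes it at most 1/4 for the rate, where the rate itself may halve in one
  step. For the convergence it is at most 1/2, since there monotonicity of
  \<open>n * \<alpha> n powr (2 - \<theta>)\<close> gives \<open>r = 2\<close>.\<close>

lemma nn_integral_normal_density:
  assumes "0 < \<sigma>"
  shows "(\<integral>\<^sup>+z. ennreal (normal_density \<mu> \<sigma> z) \<partial>lborel) = 1"
  using assms by (simp add: nn_integral_eq_integral)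

text \<open>Completing the square: the factor \<open>exp (c * z)\<close> only shifts the mean of the
  density to \<open>c\<close>.\<close>

lemma nn_integral_std_normal_exp_linear:
  "(\<integral>\<^sup>+z. ennreal (std_normal_density z * exp (c * z)) \<partial>lborel) = ennreal (exp (c\<^sup>2 / 2))"
proof -
  have "std_normal_density z * exp (c * z) = exp (c\<^sup>2 / 2) * normal_density c 1 z" for z
  proof -
    have "exp (- z\<^sup>2 / 2) * exp (c * z) = exp (c\<^sup>2 / 2) * exp (- (z - c)\<^sup>2 / 2)"
      unfolding mult_exp_exp by (simp add: power2_diff) (simp add: field_simps)
    then show ?thesis by (simp add: normal_density_def)
  qed
  then show ?thesis
    by (simp add: ennreal_mult nn_integral_cmult nn_integral_normal_density)
qed

text \<open>Here the extra factor only changes the variance to \<open>1 / (1 - a)\<close>.\<close>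

lemma nn_integral_std_normal_exp_square:
  assumes "a < 1"
  shows "(\<integral>\<^sup>+z. ennreal (std_normal_density z * exp (a * z\<^sup>2 / 2)) \<partial>lborel)
    = ennreal (1 / sqrt (1 - a))"
proof -
  define s where "s = 1 / sqrt (1 - a)"
  have s: "0 < s" "s\<^sup>2 = 1 / (1 - a)" using assms by (simp_all add: s_def power_divide)
  have "std_normal_density z * exp (a * z\<^sup>2 / 2) = s * normal_density 0 s z" for z
  proof -
    have "exp (- z\<^sup>2 / 2) * exp (a * z\<^sup>2 / 2) = exp (- (z\<^sup>2 * (1 - a)) / 2)"
      unfolding mult_exp_exp by (simp add: algebra_simps diff_divide_distrib)
    moreover have "s * (1 / sqrt (2 * pi * s\<^sup>2)) = 1 / sqrt (2 * pi)"
      using s(1) by (simp add: real_sqrt_mult)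
    ultimately show ?thesis
      unfolding normal_density_def by (simp add: s(2) mult.assoc[symmetric]) (metis mult.commute mult_1 times_divide_eq_left)
  qed
  then show ?thesis
    using s by (simp add: ennreal_mult nn_integral_cmult nn_integral_normal_density s_def[symmetric])
qed

text \<open>One square at a time is linearised: \<open>exp (k x\<^sup>2 / 2)\<close> is the average of \<open>exp (sqrt k z x)\<close>
  over a standard normal \<open>z\<close>.\<close>

lemma nn_integral_exp_square_sum_le:
  fixes X :: "'i \<Rightarrow> 'w \<Rightarrow> real"
  assumes M: "sigma_finite_measure M" and "finite I"
    and X[measurable]: "\<And>i. i \<in> I \<Longrightarrow> X i \<in> borel_measurable M"
    and sub: "\<And>t. (\<integral>\<^sup>+\<omega>. ennreal (exp (\<Sum>i\<in>I. t i * X i \<omega>)) \<partial>M)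
                \<le> ennreal (exp ((\<Sum>i\<in>I. (t i)\<^sup>2 * (s i)\<^sup>2) / 2))"
    and k: "\<And>i. i \<in> I \<Longrightarrow> 0 \<le> k i" "\<And>i. i \<in> I \<Longrightarrow> k i * (s i)\<^sup>2 < 1"
  shows "(\<integral>\<^sup>+\<omega>. ennreal (exp ((\<Sum>i\<in>I. k i * (X i \<omega>)\<^sup>2) / 2)) \<partial>M)
    \<le> ennreal (\<Prod>i\<in>I. 1 / sqrt (1 - k i * (s i)\<^sup>2))"
proof -
  interpret sigma_finite_measure M by (rule M)
  interpret pair_sigma_finite M lborel ..
  \<comment> \<open>The mixed form interpolates between the hypothesis (\<open>J\<close> empty) and
    the goal (\<open>J = I\<close>). The coefficients \<open>t\<close> stay arbitrary because
    linearising the square with index \<open>a\<close> creates the new coefficient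
    \<open>sqrt (k a) * z\<close>.\<close>
  have "(\<integral>\<^sup>+\<omega>. ennreal (exp ((\<Sum>i\<in>J. k i * (X i \<omega>)\<^sup>2) / 2 + (\<Sum>i\<in>I-J. t i * X i \<omega>))) \<partial>M)
    \<le> ennreal ((\<Prod>i\<in>J. 1 / sqrt (1 - k i * (s i)\<^sup>2)) * exp ((\<Sum>i\<in>I-J. (t i)\<^sup>2 * (s i)\<^sup>2) / 2))"
    if "J \<subseteq> I" for J t
    using finite_subset[OF that \<open>finite I\<close>] that
  proof (induction J arbitrary: t rule: finite_induct)
    case empty
    then show ?case using sub by simp
  next
    case (insert a J)
    then have a: "a \<in> I" "a \<notin> J" "J \<subseteq> I" "finite J" by auto
    have IJ: "I - J = insert a (I - insert a J)" "a \<notin> I - insert a J" "finite (I - insert a J)"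
      using a \<open>finite I\<close> by auto
    let ?Q = "\<lambda>\<omega>. (\<Sum>i\<in>J. k i * (X i \<omega>)\<^sup>2) / 2 + (\<Sum>i\<in>I-insert a J. t i * X i \<omega>)"
    let ?P = "\<Prod>i\<in>J. 1 / sqrt (1 - k i * (s i)\<^sup>2)"
    let ?E = "exp ((\<Sum>i\<in>I-insert a J. (t i)\<^sup>2 * (s i)\<^sup>2) / 2)"
    have P0: "0 \<le> ?P"
      by (intro prod_nonneg ballI) (use k a in \<open>force simp: less_imp_le\<close>)
    have [measurable]: "X i \<in> borel_measurable M" if "i \<in> J" for i using that a X by blast
    have Qm[measurable]: "?Q \<in> borel_measurable M" and [measurable]: "X a \<in> borel_measurable M"
      using a by (auto intro!: borel_measurable_add borel_measurable_sum borel_measurable_divide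
          borel_measurable_times borel_measurable_power X)
    have "(\<integral>\<^sup>+\<omega>. ennreal (exp ((\<Sum>i\<in>insert a J. k i * (X i \<omega>)\<^sup>2) / 2
              + (\<Sum>i\<in>I-insert a J. t i * X i \<omega>))) \<partial>M)
      = (\<integral>\<^sup>+\<omega>. (\<integral>\<^sup>+z. ennreal (std_normal_density z * exp (sqrt (k a) * z * X a \<omega> + ?Q \<omega>)) \<partial>lborel) \<partial>M)"
    proof (intro nn_integral_cong)
      fix \<omega>
      have "(\<integral>\<^sup>+z. ennreal (std_normal_density z * exp (sqrt (k a) * z * X a \<omega> + ?Q \<omega>)) \<partial>lborel)
        = (\<integral>\<^sup>+z. ennreal (exp (?Q \<omega>)) * ennreal (std_normal_density z * exp ((sqrt (k a) * X a \<omega>) * z)) \<partial>lborel)"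
        by (intro nn_integral_cong) (simp add: ennreal_mult[symmetric] exp_add mult_ac)
      also have "\<dots> = ennreal (exp (?Q \<omega>)) * ennreal (exp ((sqrt (k a) * X a \<omega>)\<^sup>2 / 2))"
        by (subst nn_integral_cmult) (simp_all add: nn_integral_std_normal_exp_linear)
      also have "\<dots> = ennreal (exp ((\<Sum>i\<in>insert a J. k i * (X i \<omega>)\<^sup>2) / 2
              + (\<Sum>i\<in>I-insert a J. t i * X i \<omega>)))"
        using a k(1)[of a]
        by (simp add: ennreal_mult[symmetric] mult_exp_exp power_mult_distrib add_divide_distrib add_ac)
      finally show "ennreal (exp ((\<Sum>i\<in>insert a J. k i * (X i \<omega>)\<^sup>2) / 2
              + (\<Sum>i\<in>I-insert a J. t i * X i \<omega>)))
        = (\<integral>\<^sup>+z. ennreal (std_normal_density z * exp (sqrt (k a) * z * X a \<omega> + ?Q \<omega>)) \<partial>lborel)" ..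
    qed
    also have "\<dots> = (\<integral>\<^sup>+z. (\<integral>\<^sup>+\<omega>. ennreal (std_normal_density z * exp (sqrt (k a) * z * X a \<omega> + ?Q \<omega>)) \<partial>M) \<partial>lborel)"
      by (rule Fubini'[symmetric]) measurable
    also have "\<dots> \<le> (\<integral>\<^sup>+z. ennreal (std_normal_density z * exp ((k a * (s a)\<^sup>2) * z\<^sup>2 / 2)) * ennreal (?P * ?E) \<partial>lborel)"
    proof (intro nn_integral_mono)
      fix z :: real
      \<comment> \<open>For fixed \<open>z\<close> the linearised square joins the linear part, and
        the induction hypothesis applies. Its bound contributes a Gaussian factor in
        \<open>z\<close>, integrated in closed form afterwards.\<close>
      let ?t = "t(a := sqrt (k a) * z)"
      have s1: "(\<Sum>i\<in>I-J. ?t i * X i \<omega>) = sqrt (k a) * z * X a \<omega> + (\<Sum>i\<in>I-insert a J. t i * X i \<omega>)" for \<omega>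
        using IJ(3) unfolding IJ(1) by (subst sum.insert) (auto intro!: sum.cong)
      have s2: "(\<Sum>i\<in>I-J. (?t i)\<^sup>2 * (s i)\<^sup>2) = k a * z\<^sup>2 * (s a)\<^sup>2 + (\<Sum>i\<in>I-insert a J. (t i)\<^sup>2 * (s i)\<^sup>2)"
        using IJ(3) k(1)[of a] a unfolding IJ(1)
        by (subst sum.insert) (auto intro!: sum.cong simp: power_mult_distrib)
      have "(\<integral>\<^sup>+\<omega>. ennreal (std_normal_density z * exp (sqrt (k a) * z * X a \<omega> + ?Q \<omega>)) \<partial>M)
        = ennreal (std_normal_density z) * (\<integral>\<^sup>+\<omega>. ennreal (exp ((\<Sum>i\<in>J. k i * (X i \<omega>)\<^sup>2) / 2
            + (\<Sum>i\<in>I-J. ?t i * X i \<omega>))) \<partial>M)"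
        unfolding s1
        by (subst nn_integral_cmult[symmetric])
          (use Qm in measurable, auto intro!: nn_integral_cong simp: ennreal_mult[symmetric] add_ac)
      also have "\<dots> \<le> ennreal (std_normal_density z) * ennreal (?P * exp ((\<Sum>i\<in>I-J. (?t i)\<^sup>2 * (s i)\<^sup>2) / 2))"
        by (intro mult_left_mono insert.IH) (use a in auto)
      also have "\<dots> = ennreal (std_normal_density z * exp ((k a * (s a)\<^sup>2) * z\<^sup>2 / 2)) * ennreal (?P * ?E)"
        unfolding s2 using P0
        by (simp add: ennreal_mult[symmetric] exp_add add_divide_distrib mult_ac)
      finally show "(\<integral>\<^sup>+\<omega>. ennreal (std_normal_density z * exp (sqrt (k a) * z * X a \<omega> + ?Q \<omega>)) \<partial>M)
        \<le> ennreal (std_normal_density z * exp ((k a * (s a)\<^sup>2) * z\<^sup>2 / 2)) * ennreal (?P * ?E)" .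
    qed
    also have "\<dots> = ennreal (1 / sqrt (1 - k a * (s a)\<^sup>2)) * ennreal (?P * ?E)"
      using a k(2)[of a] by (subst nn_integral_multc) (simp_all only: nn_integral_std_normal_exp_square, auto)
    also have "\<dots> = ennreal ((\<Prod>i\<in>insert a J. 1 / sqrt (1 - k i * (s i)\<^sup>2)) * ?E)"
      using a k(2)[of a] P0 by (simp add: ennreal_mult[symmetric] mult_ac)
    finally show ?case .
  qed
  from this[of I "\<lambda>_. 0"] show ?thesis by simp
qed

text \<open>Markov's inequality for the exponential moment with exponent
  \<open>l = r\<^sup>2 / 2\<close>. The weights damp the directions of large variance, so that the
  moment is at most \<open>exp (l * T)\<close> however many terms there are; at the threshold
  \<open>2 * T + 2\<close> the exponential is at least \<open>exp (l * (T + 1))\<close>, and the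
  quotient is \<open>exp (- l)\<close>.\<close>

lemma exp_tail_weighted_square_sum:
  fixes X :: "'i \<Rightarrow> 'w \<Rightarrow> real"
  assumes M: "prob_space M" and "finite I"
    and X[measurable]: "\<And>i. i \<in> I \<Longrightarrow> X i \<in> borel_measurable M"
    and sub: "\<And>t. (\<integral>\<^sup>+\<omega>. ennreal (exp (\<Sum>i\<in>I. t i * X i \<omega>)) \<partial>M)
                \<le> ennreal (exp ((\<Sum>i\<in>I. (t i)\<^sup>2 * (s i)\<^sup>2) / 2))"
    and T: "(\<Sum>i\<in>I. (s i)\<^sup>2) \<le> T"
  shows "measure M {\<omega>\<in>space M. 2 * T + 2 < (\<Sum>i\<in>I. (X i \<omega>)\<^sup>2 / (1 + r\<^sup>2 * (s i)\<^sup>2))} \<le> exp (- (r\<^sup>2 / 2))"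
proof -
  interpret prob_space M by (rule M)
  define l where "l = r\<^sup>2 / 2"
  \<comment> \<open>The weight yields both \<open>k i * (s i)\<^sup>2 \<le> 1 / 2\<close>, away from
    the singularity at 1, and \<open>k i * (s i)\<^sup>2 \<le> l * (s i)\<^sup>2\<close>, which sums
    to at most \<open>l * T\<close>.\<close>
  define k where "k i = l / (1 + r\<^sup>2 * (s i)\<^sup>2)" for i
  have l: "0 \<le> l" by (simp add: l_def)
  have pos: "0 < 1 + r\<^sup>2 * (s i)\<^sup>2" for i by (simp add: add_pos_nonneg)
  have k0: "0 \<le> k i" for i using pos[of i] l by (simp add: k_def)
  have kl: "k i * (s i)\<^sup>2 \<le> l * (s i)\<^sup>2" for i
    using pos[of i] l by (intro mult_right_mono) (auto simp: k_def divide_le_eq algebra_simps)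
  have kh: "k i * (s i)\<^sup>2 \<le> 1 / 2" for i
    using pos[of i] by (simp add: k_def l_def divide_le_eq)
  have fac: "1 / sqrt (1 - k i * (s i)\<^sup>2) \<le> exp (l * (s i)\<^sup>2)" for i
  proof -
    let ?x = "k i * (s i)\<^sup>2"
    have x: "0 \<le> ?x" "?x \<le> 1 / 2" using k0 kh by auto
    have "- ?x - 2 * ?x\<^sup>2 \<le> ln (1 - ?x)" using ln_one_minus_pos_lower_bound x by blast
    moreover have "2 * ?x\<^sup>2 \<le> ?x" using x mult_right_mono[of ?x "1/2" ?x] by (simp add: power2_eq_square)
    ultimately have "- (2 * ?x) \<le> ln (1 - ?x)" by linarith
    then have "exp (- (2 * ?x)) \<le> 1 - ?x" using x by (simp add: ln_ge_iff)
    then have "sqrt (exp (- (2 * ?x))) \<le> sqrt (1 - ?x)" by (rule real_sqrt_le_mono)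
    moreover have "sqrt (exp (- (2 * ?x))) = exp (- ?x)"
      by (rule real_sqrt_unique) (simp_all add: exp_double[symmetric])
    ultimately have "exp (- ?x) \<le> sqrt (1 - ?x)" by simp
    then have "1 / sqrt (1 - ?x) \<le> 1 / exp (- ?x)" using x by (intro divide_left_mono) auto
    also have "\<dots> = exp ?x" by (simp add: exp_minus inverse_eq_divide)
    also have "\<dots> \<le> exp (l * (s i)\<^sup>2)" using kl by simp
    finally show ?thesis .
  qed
  have fac0: "0 \<le> 1 / sqrt (1 - k i * (s i)\<^sup>2)" for i using kh[of i] by simp
  have lt1: "k i * (s i)\<^sup>2 < 1" for i using kh[of i] by simp
  let ?Q = "\<lambda>\<omega>. \<Sum>i\<in>I. (X i \<omega>)\<^sup>2 / (1 + r\<^sup>2 * (s i)\<^sup>2)"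
  let ?A = "{\<omega>\<in>space M. 2 * T + 2 < ?Q \<omega>}"
  have [measurable]: "?Q \<in> borel_measurable M"
    by (auto intro!: borel_measurable_sum borel_measurable_divide borel_measurable_power X)
  have kQ: "(\<Sum>i\<in>I. k i * (X i \<omega>)\<^sup>2) = l * ?Q \<omega>" for \<omega>
    by (simp add: k_def sum_distrib_left)
  have "ennreal (exp (l * (T + 1))) * emeasure M ?A = (\<integral>\<^sup>+\<omega>. ennreal (exp (l * (T + 1))) * indicator ?A \<omega> \<partial>M)"
    by (subst nn_integral_cmult_indicator) auto
  also have "\<dots> \<le> (\<integral>\<^sup>+\<omega>. ennreal (exp ((\<Sum>i\<in>I. k i * (X i \<omega>)\<^sup>2) / 2)) \<partial>M)"
    unfolding kQ
  proof (intro nn_integral_mono)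
    fix \<omega>
    have "l * (T + 1) \<le> l * ?Q \<omega> / 2" if "2 * T + 2 < ?Q \<omega>"
      using mult_left_mono[of "2 * T + 2" "?Q \<omega>" l] that l by (simp add: algebra_simps)
    then show "ennreal (exp (l * (T + 1))) * indicator ?A \<omega> \<le> ennreal (exp (l * ?Q \<omega> / 2))"
      by (auto simp: indicator_def intro!: ennreal_leI)
  qed
  also have "\<dots> \<le> ennreal (\<Prod>i\<in>I. 1 / sqrt (1 - k i * (s i)\<^sup>2))"
    by (rule nn_integral_exp_square_sum_le[OF sigma_finite_measure_axioms \<open>finite I\<close> X sub k0 lt1])
  also have "\<dots> \<le> ennreal (\<Prod>i\<in>I. exp (l * (s i)\<^sup>2))"
    by (intro ennreal_leI prod_mono conjI fac fac0)
  also have "\<dots> \<le> ennreal (exp (l * T))"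
    using T l \<open>finite I\<close> by (intro ennreal_leI) (simp add: exp_sum[symmetric] sum_distrib_left[symmetric] mult_left_mono)
  finally have "ennreal (exp (l * (T + 1))) * emeasure M ?A \<le> ennreal (exp (l * T))" .
  then have "ennreal (exp (l * (T + 1)) * measure M ?A) \<le> ennreal (exp (l * T))"
    by (simp add: ennreal_mult emeasure_eq_measure)
  then have "exp (l * (T + 1)) * measure M ?A \<le> exp (l * T)"
    by (simp add: ennreal_le_iff)
  then have "measure M ?A \<le> exp (l * T) / exp (l * (T + 1))" by (simp add: field_simps)
  also have "\<dots> = exp (- (r\<^sup>2 / 2))"
    by (simp add: exp_diff[symmetric] l_def algebra_simps)
  finally show ?thesis .
qed

subsection \<open>Singular value bases\<close>

text \<open>\<open>orthonormal_basis\<close> without the density clause, so that the notion passes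
  to finite subsets of a basis.\<close>

definition orthonormal_set :: "'a::real_inner set \<Rightarrow> bool" where
  "orthonormal_set B \<longleftrightarrow> pairwise orthogonal B \<and> (\<forall>b\<in>B. norm b = 1)"

lemma orthonormal_set_inner:
  assumes "orthonormal_set B" "a \<in> B" "b \<in> B"
  shows "inner a b = (if a = b then 1 else 0)"
  using assms by (auto simp: orthonormal_set_def pairwise_def orthogonal_def norm_eq_1)

lemma norm_sum_orthogonal:
  fixes f :: "'i \<Rightarrow> 'a::real_inner"
  assumes "finite I" "pairwise (\<lambda>i k. inner (f i) (f k) = 0) I"
  shows "(norm (\<Sum>i\<in>I. f i))\<^sup>2 = (\<Sum>i\<in>I. (norm (f i))\<^sup>2)"
  using assms by (intro norm_sum_Pythagorean) (auto simp: orthogonal_def)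

lemma orthonormal_expansion:
  assumes "orthonormal_set B" "finite B" "x \<in> span B"
  shows "x = (\<Sum>b\<in>B. inner x b *\<^sub>R b)"
  using orthonormal_basis_expand[of B x] assms by (simp add: orthonormal_set_def)

lemma orthonormal_norm:
  assumes "orthonormal_set B" "finite B" "x \<in> span B"
  shows "(norm x)\<^sup>2 = (\<Sum>b\<in>B. (inner x b)\<^sup>2)"
proof -
  have "(norm (\<Sum>b\<in>B. inner x b *\<^sub>R b))\<^sup>2 = (\<Sum>b\<in>B. (norm (inner x b *\<^sub>R b))\<^sup>2)"
    using assms by (intro norm_sum_orthogonal) (auto simp: pairwise_def orthonormal_set_inner)
  also have "\<dots> = (\<Sum>b\<in>B. (inner x b)\<^sup>2)"
    using assms(1) by (intro sum.cong) (auto simp: orthonormal_set_def)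
  finally show ?thesis
    using orthonormal_expansion[OF assms] by simp
qed

text \<open>Supplies compactness inside \<open>span B\<close> although the ambient space may be
  infinite-dimensional: the set is an iterated sum of segments, and sums of compact sets are
  compact.\<close>

lemma compact_box_combinations:
  assumes "finite (B :: 'a::real_normed_vector set)"
  shows "compact {\<Sum>b\<in>B. x b *\<^sub>R b | x. \<forall>b\<in>B. \<bar>x b\<bar> \<le> (1::real)}"
  using assms
proof (induction rule: finite_induct)
  case empty
  then show ?case by simp
next
  case (insert a B)
  let ?P = "{\<Sum>b\<in>B. x b *\<^sub>R b | x. \<forall>b\<in>B. \<bar>x b\<bar> \<le> (1::real)}"
  let ?L = "(\<lambda>t. t *\<^sub>R a) ` {-1..1::real}"
  have "{\<Sum>b\<in>insert a B. x b *\<^sub>R b | x. \<forall>b\<in>insert a B. \<bar>x b\<bar> \<le> (1::real)}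
    = {y + z | y z. y \<in> ?L \<and> z \<in> ?P}" (is "?lhs = ?rhs")
  proof (intro set_eqI iffI)
    fix w assume "w \<in> ?lhs"
    then obtain x where "w = x a *\<^sub>R a + (\<Sum>b\<in>B. x b *\<^sub>R b)" "\<bar>x a\<bar> \<le> 1" "\<forall>b\<in>B. \<bar>x b\<bar> \<le> 1"
      using insert by auto
    then show "w \<in> ?rhs" by (force simp: abs_le_iff)
  next
    fix w assume "w \<in> ?rhs"
    then obtain t x where x: "w = t *\<^sub>R a + (\<Sum>b\<in>B. x b *\<^sub>R b)" "\<bar>t\<bar> \<le> 1" "\<forall>b\<in>B. \<bar>x b\<bar> \<le> 1"
      by (auto simp: abs_le_iff)
    have "(\<Sum>b\<in>insert a B. (x(a := t)) b *\<^sub>R b) = w"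
      using insert x by (auto intro!: sum.cong)
    moreover have "\<forall>b\<in>insert a B. \<bar>(x(a := t)) b\<bar> \<le> 1" using x by auto
    ultimately show "w \<in> ?lhs" by blast
  qed
  moreover have "compact ?L"
    by (intro compact_continuous_image continuous_intros compact_Icc)
  ultimately show ?case using compact_sums[OF _ insert.IH, of ?L] by simp
qed

text \<open>The next singular vector, as a maximiser of \<open>norm (j v)\<close> over the unit
  sphere of the part of \<open>span B\<close> orthogonal to \<open>C\<close>. The vector
  \<open>u\<close> witnesses that this sphere is nonempty.\<close>

lemma norm_maximising_direction:
  fixes j :: "'v::real_inner \<Rightarrow> 'y::real_inner"
  assumes B: "orthonormal_set B" "finite B" and j: "bounded_linear j"
    and u: "u \<in> span B" "u \<noteq> 0" "\<And>c. c \<in> C \<Longrightarrow> inner u c = 0"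
  obtains v where "v \<in> span B" "norm v = 1" "\<And>c. c \<in> C \<Longrightarrow> inner v c = 0"
    "\<And>w. w \<in> span B \<Longrightarrow> (\<And>c. c \<in> C \<Longrightarrow> inner w c = 0) \<Longrightarrow> norm (j w) \<le> norm (j v) * norm w"
proof -
  interpret j: bounded_linear j by (rule j)
  let ?P = "{\<Sum>b\<in>B. x b *\<^sub>R b | x. \<forall>b\<in>B. \<bar>x b\<bar> \<le> (1::real)}"
  \<comment> \<open>Intersecting with the box \<open>?P\<close> gives compactness and costs nothing:
    by Cauchy--Schwarz a unit vector of \<open>span B\<close> has coefficients of modulus at most
    1.\<close>
  define S where "S = ?P \<inter> ({v. norm v = 1} \<inter> (\<Inter>c\<in>C. {v. inner v c = 0}))"
  have S_iff: "v \<in> S \<longleftrightarrow> v \<in> span B \<and> norm v = 1 \<and> (\<forall>c\<in>C. inner v c = 0)" for v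
  proof -
    have "v \<in> ?P" if "v \<in> span B" "norm v = 1"
    proof -
      have "\<bar>inner v b\<bar> \<le> 1" if "b \<in> B" for b
        using Cauchy_Schwarz_ineq2[of v b] that \<open>norm v = 1\<close> B by (simp add: orthonormal_set_def)
      then show ?thesis using orthonormal_expansion[OF B that(1)] by blast
    qed
    moreover have "?P \<subseteq> span B" by (auto intro: span_sum span_scale span_base)
    ultimately show ?thesis unfolding S_def by auto
  qed
  have "closed ({v. norm v = 1} \<inter> (\<Inter>c\<in>C. {v. inner v c = 0}))"
    by (intro closed_Int closed_INT ballI closed_Collect_eq continuous_intros)
  then have "compact S"
    unfolding S_def using compact_box_combinations[OF B(2)] by (rule compact_Int_closed[rotated])
  moreover have "u /\<^sub>R norm u \<in> S"
    using u by (simp add: S_iff span_scale)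
  moreover have "continuous_on S (\<lambda>w. norm (j w))"
    by (intro continuous_on_norm j.continuous_on continuous_on_id)
  ultimately obtain v where v: "v \<in> S" "\<And>w. w \<in> S \<Longrightarrow> norm (j w) \<le> norm (j v)"
    using continuous_attains_sup[of S "\<lambda>w. norm (j w)"] by blast
  show ?thesis
  proof (rule that)
    fix w assume w: "w \<in> span B" "\<And>c. c \<in> C \<Longrightarrow> inner w c = 0"
    show "norm (j w) \<le> norm (j v) * norm w"
    proof (cases "w = 0")
      case False
      then have "norm (j (w /\<^sub>R norm w)) \<le> norm (j v)"
        by (intro v) (simp add: S_iff span_scale w)
      then show ?thesis using False by (simp add: j.scaleR field_simps)
    qed (simp add: j.zero)
  qed (use v(1) in \<open>auto simp: S_iff\<close>)
qed

text \<open>First variation: a linear term dominated by a quadratic one for all \<open>t\<close> of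
  both signs must vanish. The choice \<open>t = a / (K + 1)\<close> already suffices.\<close>

lemma zero_if_le_quadratic:
  fixes a K :: real
  assumes "0 \<le> K" "\<And>t. 2 * t * a \<le> t\<^sup>2 * K"
  shows "a = 0"
proof -
  define p where "p = a / (K + 1)"
  have a: "a = p * (K + 1)" using assms(1) by (simp add: p_def)
  have "2 * p * a \<le> p\<^sup>2 * K" by (rule assms)
  then have "p\<^sup>2 * (K + 2) \<le> 0" by (simp add: a power2_eq_square algebra_simps)
  then show ?thesis using assms(1) by (simp add: a mult_le_0_iff)
qed

text \<open>Singular vectors are collected greedily: among the sets of admissible vectors one of
  maximal cardinality is taken, and if it did not span, a norm-maximising direction orthogonal to it
  could be added.\<close>

lemma singular_value_basis:
  fixes j :: "'v::real_inner \<Rightarrow> 'y::real_inner"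
  assumes B: "orthonormal_set B" "finite B" and j: "bounded_linear j"
  obtains C where "orthonormal_set C" "finite C" "span C = span B"
    "pairwise (\<lambda>c d. inner (j c) (j d) = 0) C"
proof -
  interpret j: bounded_linear j by (rule j)
  \<comment> \<open>The last clause is the invariant behind the extension: whatever is orthogonal to
    \<open>C\<close> has its image orthogonal to the image of \<open>C\<close>, so adding a vector
    keeps the images pairwise orthogonal.\<close>
  define good where "good C \<longleftrightarrow> finite C \<and> C \<subseteq> span B \<and> orthonormal_set C
    \<and> pairwise (\<lambda>c d. inner (j c) (j d) = 0) C
    \<and> (\<forall>c\<in>C. \<forall>u\<in>span B. (\<forall>c'\<in>C. inner u c' = 0) \<longrightarrow> inner (j c) (j u) = 0)" for C
  have card_le: "card C \<le> card B" if "good C" for C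
  proof -
    have "independent C"
      using that by (intro pairwise_orthogonal_independent) (force simp: good_def orthonormal_set_def)+
    then show ?thesis
      using independent_span_bound[OF B(2), of C] that by (auto simp: good_def)
  qed
  have "good {}" by (simp add: good_def orthonormal_set_def)
  then obtain C where C: "good C" and max: "\<And>D. good D \<Longrightarrow> card D \<le> card C"
    using ex_has_greatest_nat[of good "{}" card "Suc (card B)"] card_le by (auto simp: less_Suc_eq_le)
  note C' = C[unfolded good_def]
  have "span B \<subseteq> span C"
  proof (rule ccontr)
    assume "\<not> span B \<subseteq> span C"
    then obtain u where u: "u \<in> span B" "u \<notin> span C" by blast
    define u' where "u' = u - (\<Sum>c\<in>C. inner u c *\<^sub>R c)"
    have proj: "(\<Sum>c\<in>C. inner u c *\<^sub>R c) \<in> span C"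
      by (intro span_sum span_scale span_base)
    have "u' \<noteq> 0" using u(2) proj by (auto simp: u'_def)
    moreover have "u' \<in> span B"
      unfolding u'_def using u(1) C' by (intro span_diff span_sum span_scale) auto
    moreover have "inner u' c = 0" if "c \<in> C" for c
    proof -
      have "(\<Sum>d\<in>C. inner u d * inner d c) = (\<Sum>d\<in>C. if d = c then inner u c else 0)"
        using C' that by (intro sum.cong) (auto simp: orthonormal_set_inner)
      then show ?thesis using that C' by (simp add: u'_def inner_diff_left inner_sum_left)
    qed
    ultimately obtain v where v: "v \<in> span B" "norm v = 1" "\<And>c. c \<in> C \<Longrightarrow> inner v c = 0"
      and vmax: "\<And>w. w \<in> span B \<Longrightarrow> (\<And>c. c \<in> C \<Longrightarrow> inner w c = 0) \<Longrightarrow> norm (j w) \<le> norm (j v) * norm w"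
      using norm_maximising_direction[OF B j, of u' C] by blast
    \<comment> \<open>The maximiser is a critical point: along \<open>v + t *\<^sub>R w\<close> with
      \<open>w\<close> orthogonal to \<open>v\<close>, the squared norm changes only to second order
      in \<open>t\<close>, so the first-order term of the squared image norm vanishes.\<close>
    have jv: "inner (j v) (j w) = 0"
      if w: "w \<in> span B" "\<And>c. c \<in> C \<Longrightarrow> inner w c = 0" "inner w v = 0" for w
    proof (rule zero_if_le_quadratic)
      show "0 \<le> (norm (j v))\<^sup>2 * (norm w)\<^sup>2" by simp
      fix t :: real
      have "norm (j (v + t *\<^sub>R w)) \<le> norm (j v) * norm (v + t *\<^sub>R w)"
        using v w by (intro vmax span_add span_scale) (auto simp: inner_add_left)
      then have "(norm (j (v + t *\<^sub>R w)))\<^sup>2 \<le> (norm (j v) * norm (v + t *\<^sub>R w))\<^sup>2"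
        by (intro power_mono) auto
      moreover have "(norm (v + t *\<^sub>R w))\<^sup>2 = 1 + t\<^sup>2 * (norm w)\<^sup>2"
        unfolding power2_norm_eq_inner using v(2) w(3)
        by (simp add: inner_add_left inner_add_right inner_commute[of w v] norm_eq_1 power2_eq_square)
      moreover have "(norm (j (v + t *\<^sub>R w)))\<^sup>2
        = (norm (j v))\<^sup>2 + 2 * t * inner (j v) (j w) + t\<^sup>2 * (norm (j w))\<^sup>2"
        unfolding power2_norm_eq_inner
        by (simp add: j.add j.scaleR inner_add_left inner_add_right inner_commute[of "j w" "j v"] power2_eq_square distrib_left)
      ultimately have "2 * t * inner (j v) (j w) + t\<^sup>2 * (norm (j w))\<^sup>2
          \<le> t\<^sup>2 * ((norm (j v))\<^sup>2 * (norm w)\<^sup>2)"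
        by (simp add: power_mult_distrib algebra_simps)
      moreover have "0 \<le> t\<^sup>2 * (norm (j w))\<^sup>2" by simp
      ultimately show "2 * t * inner (j v) (j w) \<le> t\<^sup>2 * ((norm (j v))\<^sup>2 * (norm w)\<^sup>2)" by linarith
    qed
    have "v \<notin> C" using v by (metis inner_eq_zero_iff norm_zero zero_neq_one)
    moreover have "good (insert v C)"
      unfolding good_def
    proof (intro conjI)
      show "orthonormal_set (insert v C)"
        using C' v by (auto simp: orthonormal_set_def pairwise_insert orthogonal_def inner_commute)
      have "inner (j c) (j v) = 0" if "c \<in> C" for c using C' v that by blast
      then show "pairwise (\<lambda>c d. inner (j c) (j d) = 0) (insert v C)"
        using C' by (auto simp: pairwise_insert inner_commute)
      show "\<forall>c\<in>insert v C. \<forall>u\<in>span B. (\<forall>c'\<in>insert v C. inner u c' = 0) \<longrightarrow> inner (j c) (j u) = 0"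
        using C' jv by auto
    qed (use C' v in auto)
    ultimately show False using max[of "insert v C"] C' by simp
  qed
  moreover have "span C \<subseteq> span B" using C' by (intro span_minimal subspace_span) auto
  ultimately show ?thesis using that C' by blast
qed

text \<open>Basis independence of the Hilbert--Schmidt norm. Each \<open>b\<close> is expanded in
  \<open>C\<close>, whose images are orthogonal, the sums are swapped, and Parseval is applied to
  each \<open>c\<close>. This carries the trace bound over to the singular vectors.\<close>

lemma orthonormal_trace_eq:
  fixes j :: "'v::real_inner \<Rightarrow> 'y::real_inner"
  assumes B: "orthonormal_set B" "finite B" and C: "orthonormal_set C" "finite C"
    and span: "span C = span B" and "linear j"
    and orth: "pairwise (\<lambda>c d. inner (j c) (j d) = 0) C"
  shows "(\<Sum>c\<in>C. (norm (j c))\<^sup>2) = (\<Sum>b\<in>B. (norm (j b))\<^sup>2)"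
proof -
  interpret j: linear j by fact
  have "(norm (j b))\<^sup>2 = (\<Sum>c\<in>C. (inner b c)\<^sup>2 * (norm (j c))\<^sup>2)" if "b \<in> B" for b
  proof -
    have "b \<in> span C" using that span span_base by blast
    then have "j b = (\<Sum>c\<in>C. inner b c *\<^sub>R j c)"
      by (subst orthonormal_expansion[OF C]) (simp_all add: j.sum j.scale)
    moreover have "(norm (\<Sum>c\<in>C. inner b c *\<^sub>R j c))\<^sup>2 = (\<Sum>c\<in>C. (norm (inner b c *\<^sub>R j c))\<^sup>2)"
      using C orth by (intro norm_sum_orthogonal) (auto simp: pairwise_def)
    ultimately show ?thesis by (simp add: power_mult_distrib)
  qed
  then have "(\<Sum>b\<in>B. (norm (j b))\<^sup>2) = (\<Sum>b\<in>B. \<Sum>c\<in>C. (inner b c)\<^sup>2 * (norm (j c))\<^sup>2)"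
    by simp
  also have "\<dots> = (\<Sum>c\<in>C. \<Sum>b\<in>B. (inner b c)\<^sup>2 * (norm (j c))\<^sup>2)" by (rule sum.swap)
  also have "\<dots> = (\<Sum>c\<in>C. (\<Sum>b\<in>B. (inner c b)\<^sup>2) * (norm (j c))\<^sup>2)"
    by (simp only: sum_distrib_right inner_commute)
  also have "\<dots> = (\<Sum>c\<in>C. (norm (j c))\<^sup>2)"
  proof (intro sum.cong refl)
    fix c assume "c \<in> C"
    then have "c \<in> span B" using span span_base by blast
    then have "(\<Sum>b\<in>B. (inner c b)\<^sup>2) = (norm c)\<^sup>2" using orthonormal_norm[OF B] by simp
    then show "(\<Sum>b\<in>B. (inner c b)\<^sup>2) * (norm (j c))\<^sup>2 = (norm (j c))\<^sup>2"
      using C \<open>c \<in> C\<close> by (simp add: orthonormal_set_def)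
  qed
  finally show ?thesis ..
qed

text \<open>Weighted Cauchy--Schwarz. Since both \<open>C\<close> and its image are orthogonal, the
  quadratic form \<open>(norm v)\<^sup>2 + r\<^sup>2 * (norm (j v))\<^sup>2\<close> is diagonal in
  \<open>C\<close> with entries \<open>1 + r\<^sup>2 * (norm (j c))\<^sup>2\<close>; the second
  factor is the dual form, the one with the exponential tail.\<close>

lemma functional_bound_singular_basis:
  fixes j :: "'v::real_inner \<Rightarrow> 'y::real_inner" and L :: "'y \<Rightarrow> real"
  assumes C: "orthonormal_set C" "finite C" and j: "linear j" and L: "linear L"
    and orth: "pairwise (\<lambda>c d. inner (j c) (j d) = 0) C" and v: "v \<in> span C"
  shows "(L (j v))\<^sup>2 \<le> ((norm v)\<^sup>2 + r\<^sup>2 * (norm (j v))\<^sup>2)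
    * (\<Sum>c\<in>C. (L (j c))\<^sup>2 / (1 + r\<^sup>2 * (norm (j c))\<^sup>2))"
proof -
  interpret j: linear j by fact
  interpret L: linear L by fact
  let ?w = "\<lambda>c. 1 + r\<^sup>2 * (norm (j c))\<^sup>2"
  have w: "0 < ?w c" for c by (simp add: add_pos_nonneg)
  have vj: "j v = (\<Sum>c\<in>C. inner v c *\<^sub>R j c)"
    by (subst orthonormal_expansion[OF C v]) (simp add: j.sum j.scale)
  have "(norm (\<Sum>c\<in>C. inner v c *\<^sub>R j c))\<^sup>2 = (\<Sum>c\<in>C. (norm (inner v c *\<^sub>R j c))\<^sup>2)"
    using C orth by (intro norm_sum_orthogonal) (auto simp: pairwise_def)
  then have "(norm (j v))\<^sup>2 = (\<Sum>c\<in>C. (inner v c)\<^sup>2 * (norm (j c))\<^sup>2)"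
    by (simp add: vj power_mult_distrib)
  then have "(norm v)\<^sup>2 + r\<^sup>2 * (norm (j v))\<^sup>2
      = (\<Sum>c\<in>C. (inner v c)\<^sup>2 + r\<^sup>2 * ((inner v c)\<^sup>2 * (norm (j c))\<^sup>2))"
    by (simp add: orthonormal_norm[OF C v] sum.distrib sum_distrib_left)
  also have "\<dots> = (\<Sum>c\<in>C. (inner v c * sqrt (?w c))\<^sup>2)"
    using less_imp_le[OF w] by (intro sum.cong refl) (simp add: power_mult_distrib algebra_simps)
  finally have "(norm v)\<^sup>2 + r\<^sup>2 * (norm (j v))\<^sup>2 = (\<Sum>c\<in>C. (inner v c * sqrt (?w c))\<^sup>2)" .
  moreover have "(\<Sum>c\<in>C. (L (j c))\<^sup>2 / ?w c) = (\<Sum>c\<in>C. (L (j c) / sqrt (?w c))\<^sup>2)"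
    using less_imp_le[OF w] by (simp add: power_divide)
  moreover have "L (j v) = (\<Sum>c\<in>C. (inner v c * sqrt (?w c)) * (L (j c) / sqrt (?w c)))"
  proof -
    have "sqrt (?w c) \<noteq> 0" for c using w[of c] by simp
    then have "(inner v c * sqrt (?w c)) * (L (j c) / sqrt (?w c)) = inner v c * L (j c)" for c
      by simp
    then show ?thesis by (simp only: vj L.sum L.scale real_scaleR_def)
  qed
  ultimately show ?thesis
    using Cauchy_Schwarz_ineq_sum[of "\<lambda>c. inner v c * sqrt (?w c)" "\<lambda>c. L (j c) / sqrt (?w c)" C] by simp
qed

subsection \<open>The averaged noise\<close>

lemma process_law_coordinate:
  assumes X: "\<And>g. X g \<in> borel_measurable M" and Y: "\<And>g. Y g \<in> borel_measurable M"
    and eq: "process_law M X = process_law M Y"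
  shows "distr M borel (X g) = distr M borel (Y g)"
proof -
  have "distr (process_law M Z) borel (\<lambda>f. f g) = distr M borel (Z g)"
    if "\<And>g. Z g \<in> borel_measurable M" for Z :: "'a \<Rightarrow> 'b \<Rightarrow> real"
  proof -
    have "(\<lambda>\<omega> g. Z g \<omega>) \<in> measurable M (PiM UNIV (\<lambda>_. borel))"
      by (rule measurable_PiM_single') (use that in auto)
    then show ?thesis
      unfolding process_law_def by (subst distr_distr) (auto simp: comp_def)
  qed
  from this[of X] this[of Y] show ?thesis using X Y eq by simp
qed

text \<open>The noise is indexed from 1 but the central limit theorem from 0; independence is
  transported along \<open>Suc\<close>.\<close>

lemma (in prob_space) indep_sets_reindex:
  assumes F: "indep_sets F (f ` I)" and inj: "inj_on f I"
  shows "indep_sets (\<lambda>i. F (f i)) I"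
proof (rule indep_setsI)
  fix A J assume J: "J \<noteq> {}" "J \<subseteq> I" "finite J" and A: "\<forall>j\<in>J. A j \<in> F (f j)"
  define A' where "A' i = A (inv_into J f i)" for i
  have inj': "inj_on f J" using inj J(2) by (rule inj_on_subset)
  have A': "A' (f j) = A j" if "j \<in> J" for j
    using that inj' by (simp add: A'_def)
  have "prob (\<Inter>i\<in>f ` J. A' i) = (\<Prod>i\<in>f ` J. prob (A' i))"
    using J A A' by (intro indep_setsD[OF F]) auto
  moreover have "(\<Inter>i\<in>f ` J. A' i) = (\<Inter>j\<in>J. A j)" using A' by auto
  moreover have "(\<Prod>i\<in>f ` J. prob (A' i)) = (\<Prod>j\<in>J. prob (A j))"
    using A' inj' by (simp add: prod.reindex)
  ultimately show "prob (\<Inter>j\<in>J. A j) = (\<Prod>j\<in>J. prob (A j))" by simp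
qed (use F in \<open>auto simp: indep_sets_def\<close>)

lemma (in prob_space) noise_sum_law:
  fixes j :: "'v::real_inner \<Rightarrow> 'y::real_inner"
  assumes noise: "noise_sequence M j \<xi>" and n: "n \<ge> 1"
  shows "distr M borel (\<lambda>\<omega>. \<Sum>i=1..n. \<xi> i g \<omega>) = distr M borel (\<lambda>\<omega>. sqrt n * \<xi> 1 g \<omega>)"
proof -
  have m: "\<xi> i h \<in> borel_measurable M" if "i \<ge> 1" for i h
    using noise that by (simp add: noise_sequence_def hilbert_space_process_def)
  show ?thesis
  proof (rule process_law_coordinate)
    show "process_law M (\<lambda>g \<omega>. \<Sum>i=1..n. \<xi> i g \<omega>) = process_law M (\<lambda>g \<omega>. sqrt n * \<xi> 1 g \<omega>)"
      using noise n unfolding noise_sequence_def by blast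
  qed (auto intro!: borel_measurable_sum m borel_measurable_times)
qed

text \<open>Discards the term at 0, where the normalised sum is the empty sum and does not have the
  common law.\<close>

lemma weak_conv_m_Suc:
  assumes "weak_conv_m f \<mu>"
  shows "weak_conv_m (\<lambda>n. f (Suc n)) \<mu>"
  using assms LIMSEQ_Suc[of "\<lambda>n. cdf (f n) _"] unfolding weak_conv_m_def weak_conv_def by blast

text \<open>The sums \<open>S n / sqrt n\<close> have a law independent of \<open>n\<close>, which by the central limit theorem
  must be normal.\<close>

lemma (in prob_space) noise_gaussian:
  fixes j :: "'v::real_inner \<Rightarrow> 'y::real_inner"
  assumes noise: "noise_sequence M j \<xi>"
    and pos: "expectation (\<lambda>\<omega>. (\<xi> 1 g \<omega>)\<^sup>2) = s\<^sup>2" "0 < s"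
  shows "distr M borel (\<lambda>\<omega>. \<xi> 1 g \<omega> / s) = std_normal_distribution"
proof -
  have pr: "hilbert_space_process M (\<xi> i)" "centered_process M (\<xi> i)" if "i \<ge> 1" for i
    using noise that by (auto simp: noise_sequence_def)
  have m[measurable]: "\<xi> i h \<in> borel_measurable M" if "i \<ge> 1" for i h
    using pr[OF that] by (simp add: hilbert_space_process_def)
  have sq: "integrable M (\<lambda>\<omega>. (\<xi> i h \<omega>)\<^sup>2)" if "i \<ge> 1" for i h
    using pr[OF that] by (simp add: hilbert_space_process_def)
  have mean: "expectation (\<xi> i h) = 0" if "i \<ge> 1" for i h
    using pr[OF that] by (simp add: centered_process_def)
  have iid: "indep_vars (\<lambda>_. PiM UNIV (\<lambda>_. borel)) (\<lambda>i \<omega> g. \<xi> i g \<omega>) {1..}"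
    "\<And>i. i \<ge> 1 \<Longrightarrow> process_law M (\<xi> i) = process_law M (\<xi> 1)"
    using noise unfolding noise_sequence_def iid_processes_def by blast+
  have law: "distr M borel (\<xi> i g) = distr M borel (\<xi> 1 g)" if "i \<ge> 1" for i
    by (rule process_law_coordinate[OF m m iid(2)]) (use that in auto)
  define X where "X n = \<xi> (Suc n) g" for n
  have X_sq: "expectation (\<lambda>\<omega>. (X n \<omega>)\<^sup>2) = s\<^sup>2" for n
  proof -
    have "expectation (\<lambda>\<omega>. (\<xi> i g \<omega>)\<^sup>2) = integral\<^sup>L (distr M borel (\<xi> i g)) (\<lambda>x. x\<^sup>2)" if "i \<ge> 1" for i
      using that by (subst integral_distr) (auto intro: m)
    then show ?thesis using law[of "Suc n"] pos(1) by (simp add: X_def)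
  qed
  have "weak_conv_m (\<lambda>n. distr M borel (\<lambda>x. (\<Sum>i<n. X i x) / sqrt (n * s\<^sup>2))) std_normal_distribution"
  proof (rule central_limit_theorem_zero_mean[where \<mu> = "distr M borel (\<xi> 1 g)"])
    have "indep_vars (\<lambda>_. borel) (\<lambda>i. \<xi> i g) {1..}"
      using indep_vars_compose2[OF iid(1), of "\<lambda>_ f. f g" "\<lambda>_. borel"] by simp
    then have "indep_vars (\<lambda>_. borel) (\<lambda>i. \<xi> i g) (range Suc)"
      by (rule indep_vars_subset) auto
    then show "indep_vars (\<lambda>_. borel) X UNIV"
      unfolding indep_vars_def2 X_def
      using indep_sets_reindex[of "\<lambda>i. {\<xi> i g -` A \<inter> space M |A. A \<in> sets borel}" Suc UNIV] by auto
    show "0 < s" by fact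
    fix n
    show "expectation (X n) = 0" unfolding X_def by (rule mean) simp
    then show "variance (X n) = s\<^sup>2" using X_sq by simp
    show "integrable M (\<lambda>x. (X n x)\<^sup>2)" unfolding X_def by (rule sq) simp
    show "distr M borel (X n) = distr M borel (\<xi> 1 g)" unfolding X_def by (rule law) simp
  qed
  then have conv: "weak_conv_m (\<lambda>n. distr M borel (\<lambda>x. (\<Sum>i<Suc n. X i x) / sqrt (Suc n * s\<^sup>2))) std_normal_distribution"
    by (rule weak_conv_m_Suc)
  \<comment> \<open>The assumed equality in law of the noise sums cancels the normalisation: each
    normalised sum is distributed as \<open>\<xi> 1 g / s\<close>.\<close>
  have "distr M borel (\<lambda>x. (\<Sum>i<Suc n. X i x) / sqrt (Suc n * s\<^sup>2)) = distr M borel (\<lambda>x. \<xi> 1 g x / s)" for n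
  proof -
    have "distr M borel (\<lambda>\<omega>. \<Sum>i=1..Suc n. \<xi> i g \<omega>) = distr M borel (\<lambda>\<omega>. sqrt (real (Suc n)) * \<xi> 1 g \<omega>)"
      by (rule noise_sum_law[OF noise]) simp
    then have "distr (distr M borel (\<lambda>\<omega>. \<Sum>i=1..Suc n. \<xi> i g \<omega>)) borel (\<lambda>x. x / sqrt (Suc n * s\<^sup>2))
        = distr (distr M borel (\<lambda>\<omega>. sqrt (real (Suc n)) * \<xi> 1 g \<omega>)) borel (\<lambda>x. x / sqrt (Suc n * s\<^sup>2))"
      by simp
    then have "distr M borel (\<lambda>\<omega>. (\<Sum>i=1..Suc n. \<xi> i g \<omega>) / sqrt (Suc n * s\<^sup>2))
        = distr M borel (\<lambda>\<omega>. (sqrt (real (Suc n)) * \<xi> 1 g \<omega>) / sqrt (Suc n * s\<^sup>2))"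
      by (subst (asm) (1 2) distr_distr)
        (auto intro!: borel_measurable_sum m borel_measurable_times simp: comp_def simp del: of_nat_Suc)
    moreover have "(\<Sum>i=1..Suc n. \<xi> i g \<omega>) = (\<Sum>i<Suc n. X i \<omega>)" for \<omega>
      unfolding X_def by (rule sum.reindex_bij_witness[of _ Suc "\<lambda>i. i - 1"]) auto
    moreover have "(sqrt (real (Suc n)) * x) / sqrt (Suc n * s\<^sup>2) = x / s" for x
      using pos(2) by (simp add: real_sqrt_mult del: of_nat_Suc)
    ultimately show ?thesis by (simp del: of_nat_Suc)
  qed
  then have conv': "weak_conv_m (\<lambda>n::nat. distr M borel (\<lambda>x. \<xi> 1 g x / s)) std_normal_distribution"
    using conv by simp
  have rd: "real_distribution (distr M borel (\<lambda>x. \<xi> 1 g x / s))"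
    by (rule real_distribution_distr) (use m in simp)
  have rdn: "real_distribution std_normal_distribution"
    by (rule real_dist_normal_dist)
  \<comment> \<open>The sequence of laws is constant, so its characteristic functions equal their
    limit.\<close>
  have "char (distr M borel (\<lambda>x. \<xi> 1 g x / s)) t = char std_normal_distribution t" for t
    using levy_continuity1[OF rd rdn conv', of t] by (simp add: LIMSEQ_const_iff)
  then show ?thesis using Levy_uniqueness[OF rd rdn] by blast
qed

lemma nn_integral_exp_std_normal_distribution:
  "(\<integral>\<^sup>+x. ennreal (exp (c * x)) \<partial>std_normal_distribution) = ennreal (exp (c\<^sup>2 / 2))"
  by (subst nn_integral_density)
    (auto simp: ennreal_mult[symmetric] nn_integral_std_normal_exp_linear)

text \<open>The normalised sum has the law of \<open>\<xi> 1 g\<close>, which is centred normal with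
  variance \<open>inner (K g) g\<close>; the bound on the covariance operator makes this at most
  \<open>(norm g)\<^sup>2\<close>.\<close>

lemma (in prob_space) noise_subgaussian:
  fixes j :: "'v::real_inner \<Rightarrow> 'y::real_inner"
  assumes noise: "noise_sequence M j \<xi>" and n: "n \<ge> 1"
  shows "(\<integral>\<^sup>+\<omega>. ennreal (exp ((\<Sum>i=1..n. \<xi> i g \<omega>) / sqrt n)) \<partial>M) \<le> ennreal (exp ((norm g)\<^sup>2 / 2))"
proof -
  have pr: "hilbert_space_process M (\<xi> i)" "centered_process M (\<xi> i)" if "i \<ge> 1" for i
    using noise that by (auto simp: noise_sequence_def)
  have m[measurable]: "\<xi> i h \<in> borel_measurable M" if "i \<ge> 1" for i h
    using pr[OF that] by (simp add: hilbert_space_process_def)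
  have sq: "integrable M (\<lambda>\<omega>. (\<xi> 1 g \<omega>)\<^sup>2)"
    using pr[of 1] by (simp add: hilbert_space_process_def)
  have mean: "expectation (\<xi> 1 h) = 0" for h
    using pr[of 1] by (simp add: centered_process_def)
  obtain K where K: "covariance_operator M (\<xi> 1) K" "onorm K \<le> 1"
    using noise by (auto simp: noise_sequence_def)
  define V where "V = expectation (\<lambda>\<omega>. (\<xi> 1 g \<omega>)\<^sup>2)"
  have V0: "0 \<le> V" by (simp add: V_def)
  have "V = inner (K g) g"
    using K(1) by (simp add: covariance_operator_def mean V_def power2_eq_square del: One_nat_def)
  also have "\<dots> \<le> norm (K g) * norm g" by (rule norm_cauchy_schwarz)
  also have "\<dots> \<le> (1 * norm g) * norm g"
    using K by (intro mult_right_mono order_trans[OF onorm[of K g]])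
      (auto simp: covariance_operator_def intro!: mult_right_mono)
  finally have V1: "V \<le> (norm g)\<^sup>2" by (simp add: power2_eq_square)
  have eqd: "distr M borel (\<lambda>\<omega>. \<Sum>i=1..n. \<xi> i g \<omega>) = distr M borel (\<lambda>\<omega>. sqrt n * \<xi> 1 g \<omega>)"
    by (rule noise_sum_law[OF noise n])
  have "(\<integral>\<^sup>+\<omega>. ennreal (exp ((\<Sum>i=1..n. \<xi> i g \<omega>) / sqrt n)) \<partial>M)
    = (\<integral>\<^sup>+x. ennreal (exp (x / sqrt n)) \<partial>distr M borel (\<lambda>\<omega>. \<Sum>i=1..n. \<xi> i g \<omega>))"
    by (subst nn_integral_distr) (auto intro!: borel_measurable_sum m)
  also have "\<dots> = (\<integral>\<^sup>+\<omega>. ennreal (exp (\<xi> 1 g \<omega>)) \<partial>M)"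
    unfolding eqd using n by (subst nn_integral_distr) (auto intro!: m borel_measurable_times)
  also have "\<dots> \<le> ennreal (exp ((norm g)\<^sup>2 / 2))"
  \<comment> \<open>Normality is stated after division by the standard deviation; with zero variance
    the pairing vanishes almost surely instead.\<close>
  proof (cases "V = 0")
    case True
    have "AE \<omega> in M. (\<xi> 1 g \<omega>)\<^sup>2 = 0"
      using True sq by (subst (asm) V_def) (simp add: integral_nonneg_eq_0_iff_AE)
    then have "AE \<omega> in M. ennreal (exp (\<xi> 1 g \<omega>)) = 1" by auto
    then have "(\<integral>\<^sup>+\<omega>. ennreal (exp (\<xi> 1 g \<omega>)) \<partial>M) = (\<integral>\<^sup>+\<omega>. 1 \<partial>M)"
      by (rule nn_integral_cong_AE)
    also have "\<dots> = 1" by (simp add: emeasure_space_1)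
    also have "\<dots> \<le> ennreal (exp ((norm g)\<^sup>2 / 2))" by simp
    finally show ?thesis .
  next
    case False
    define s where "s = sqrt V"
    have s: "0 < s" "s\<^sup>2 = V" using False V0 by (auto simp: s_def)
    have "(\<integral>\<^sup>+\<omega>. ennreal (exp (\<xi> 1 g \<omega>)) \<partial>M)
      = (\<integral>\<^sup>+x. ennreal (exp (s * x)) \<partial>distr M borel (\<lambda>\<omega>. \<xi> 1 g \<omega> / s))"
      using s m[of 1 g] by (subst nn_integral_distr) auto
    also have "\<dots> = (\<integral>\<^sup>+x. ennreal (exp (s * x)) \<partial>std_normal_distribution)"
      using noise_gaussian[OF noise, of g s] s by (simp add: V_def)
    also have "\<dots> \<le> ennreal (exp ((norm g)\<^sup>2 / 2))"
      using V1 s(2) by (simp add: nn_integral_exp_std_normal_distribution ennreal_leI)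
    finally show ?thesis .
  qed
  finally show ?thesis .
qed

section \<open>Almost sure bounds, uniform in the argument and in the number of observations\<close>

lemma noise_sequence_AE_linear:
  assumes noise: "noise_sequence M j \<xi>"
  shows "AE \<omega> in M. \<forall>i\<ge>1. linear (\<lambda>g. \<xi> i g \<omega>) \<and> bounded_linear (\<lambda>v. \<xi> i (j v) \<omega>)"
  unfolding AE_all_countable
proof
  fix i :: nat
  have "1 \<le> i \<longrightarrow> (AE \<omega> in M. linear (\<lambda>g. \<xi> i g \<omega>) \<and> bounded_linear (\<lambda>v. \<xi> i (j v) \<omega>))"
    using noise unfolding noise_sequence_def by blast
  then show "AE \<omega> in M. 1 \<le> i \<longrightarrow> linear (\<lambda>g. \<xi> i g \<omega>) \<and> bounded_linear (\<lambda>v. \<xi> i (j v) \<omega>)"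
    by (cases "1 \<le> i") auto
qed

text \<open>One exceptional set serves all \<open>v\<close>, and the dimension of
  \<open>span B\<close> enters neither its probability bound nor the constant, which contains only
  \<open>T\<close>.\<close>

lemma (in prob_space) noise_bound_finite_span:
  fixes j :: "'v::real_inner \<Rightarrow> 'y::real_inner"
  assumes noise: "noise_sequence M j \<xi>" and j: "bounded_linear j" and n: "n \<ge> 1"
    and B: "orthonormal_set B" "finite B" and T: "(\<Sum>b\<in>B. (norm (j b))\<^sup>2) \<le> T"
    and lin: "AE \<omega> in M. \<forall>i\<ge>1. linear (\<lambda>g. \<xi> i g \<omega>)"
  obtains A where "A \<in> sets M" "measure M A \<le> exp (- (r\<^sup>2 / 2))"
    "AE \<omega> in M. \<omega> \<notin> A \<longrightarrow> (\<forall>v\<in>span B. ((\<Sum>i=1..n. \<xi> i (j v) \<omega>) / sqrt n)\<^sup>2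
        \<le> (2 * T + 2) * ((norm v)\<^sup>2 + r\<^sup>2 * (norm (j v))\<^sup>2))"
proof -
  interpret j: bounded_linear j by (rule j)
  have m[measurable]: "\<xi> i h \<in> borel_measurable M" if "i \<ge> 1" for i h
    using noise that by (simp add: noise_sequence_def hilbert_space_process_def)
  define W where "W g \<omega> = (\<Sum>i=1..n. \<xi> i g \<omega>) / sqrt n" for g \<omega>
  have Wm[measurable]: "W g \<in> borel_measurable M" for g
    unfolding W_def by (auto intro!: borel_measurable_sum m borel_measurable_divide)
  have Wlin: "AE \<omega> in M. linear (\<lambda>g. W g \<omega>)"
    using lin
  proof eventually_elim
    case (elim \<omega>)
    then have "linear (\<lambda>g. \<xi> i g \<omega>)" if "i \<in> {1..n}" for i using that by auto
    then have "linear (\<lambda>g. \<Sum>i=1..n. \<xi> i g \<omega>)"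
      by (intro linear_compose_sum) auto
    then show ?case
      unfolding W_def linear_iff by (simp add: add_divide_distrib)
  qed
  obtain C where C: "orthonormal_set C" "finite C" "span C = span B"
    and orth: "pairwise (\<lambda>c d. inner (j c) (j d) = 0) C"
    using singular_value_basis[OF B j] by blast
  have TC: "(\<Sum>c\<in>C. (norm (j c))\<^sup>2) \<le> T"
    using orthonormal_trace_eq[OF B C j.linear_axioms orth] T by simp
  define A where "A = {\<omega>\<in>space M. 2 * T + 2 < (\<Sum>c\<in>C. (W (j c) \<omega>)\<^sup>2 / (1 + r\<^sup>2 * (norm (j c))\<^sup>2))}"
  have "A \<in> sets M" unfolding A_def by measurable
  moreover have "measure M A \<le> exp (- (r\<^sup>2 / 2))"
    unfolding A_def
  proof (rule exp_tail_weighted_square_sum[OF prob_space_axioms C(2) Wm _ TC])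
    fix t :: "'v \<Rightarrow> real"
    have "(\<integral>\<^sup>+\<omega>. ennreal (exp (\<Sum>c\<in>C. t c * W (j c) \<omega>)) \<partial>M)
      = (\<integral>\<^sup>+\<omega>. ennreal (exp (W (\<Sum>c\<in>C. t c *\<^sub>R j c) \<omega>)) \<partial>M)"
    \<comment> \<open>Almost sure linearity merges the combination into one pairing with the sum of
      the \<open>t c *\<^sub>R j c\<close>; orthogonality of the images then splits its squared
      norm, as the tail bound requires.\<close>
    proof (rule nn_integral_cong_AE)
      show "AE \<omega> in M. ennreal (exp (\<Sum>c\<in>C. t c * W (j c) \<omega>)) = ennreal (exp (W (\<Sum>c\<in>C. t c *\<^sub>R j c) \<omega>))"
        using Wlin by eventually_elim (simp add: linear_sum[of "\<lambda>g. W g _"] linear_scale[of "\<lambda>g. W g _"])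
    qed
    also have "\<dots> \<le> ennreal (exp ((norm (\<Sum>c\<in>C. t c *\<^sub>R j c))\<^sup>2 / 2))"
      unfolding W_def by (rule noise_subgaussian[OF noise n])
    also have "(norm (\<Sum>c\<in>C. t c *\<^sub>R j c))\<^sup>2 = (\<Sum>c\<in>C. (norm (t c *\<^sub>R j c))\<^sup>2)"
      using C(2) orth by (intro norm_sum_orthogonal) (auto simp: pairwise_def)
    finally show "(\<integral>\<^sup>+\<omega>. ennreal (exp (\<Sum>c\<in>C. t c * W (j c) \<omega>)) \<partial>M)
        \<le> ennreal (exp ((\<Sum>c\<in>C. (t c)\<^sup>2 * (norm (j c))\<^sup>2) / 2))"
      by (simp add: power_mult_distrib)
  qed
  moreover have "AE \<omega> in M. \<omega> \<notin> A \<longrightarrow> (\<forall>v\<in>span B. (W (j v) \<omega>)\<^sup>2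
        \<le> (2 * T + 2) * ((norm v)\<^sup>2 + r\<^sup>2 * (norm (j v))\<^sup>2))"
    using Wlin AE_space
  proof eventually_elim
    case (elim \<omega>)
    show ?case
    proof (intro impI ballI)
      fix v assume v: "\<omega> \<notin> A" "v \<in> span B"
      have "(W (j v) \<omega>)\<^sup>2 \<le> ((norm v)\<^sup>2 + r\<^sup>2 * (norm (j v))\<^sup>2)
          * (\<Sum>c\<in>C. (W (j c) \<omega>)\<^sup>2 / (1 + r\<^sup>2 * (norm (j c))\<^sup>2))"
        using functional_bound_singular_basis[OF C(1,2) j.linear_axioms elim(1) orth, of v r] v C(3) by simp
      also have "\<dots> \<le> ((norm v)\<^sup>2 + r\<^sup>2 * (norm (j v))\<^sup>2) * (2 * T + 2)"
        using v(1) elim(2) by (intro mult_left_mono) (auto simp: A_def not_less)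
      finally show "(W (j v) \<omega>)\<^sup>2 \<le> (2 * T + 2) * ((norm v)\<^sup>2 + r\<^sup>2 * (norm (j v))\<^sup>2)"
        by (simp add: mult.commute)
    qed
  qed
  ultimately show ?thesis using that unfolding W_def by blast
qed

text \<open>The limes inferior of the sets is an increasing union of tail intersections, each
  contained in some \<open>A k\<close>. Unlike a union bound this does not add up
  probabilities.\<close>

lemma (in finite_measure) measure_eventually_le:
  fixes A :: "nat \<Rightarrow> 'a set"
  assumes A: "\<And>m. A m \<in> sets M" "\<And>m. measure M (A m) \<le> p"
  shows "(\<Union>k. \<Inter>m\<in>{k..}. A m) \<in> sets M" "measure M (\<Union>k. \<Inter>m\<in>{k..}. A m) \<le> p"
proof -
  have I: "(\<Inter>m\<in>{k..}. A m) \<in> sets M" for k :: nat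
    using A(1) by (intro sets.countable_INT) auto
  then show "(\<Union>k. \<Inter>m\<in>{k..}. A m) \<in> sets M" by auto
  have "(\<lambda>k. measure M (\<Inter>m\<in>{k..}. A m)) \<longlonglongrightarrow> measure M (\<Union>k. \<Inter>m\<in>{k..}. A m)"
    using I by (intro finite_Lim_measure_incseq) (auto simp: incseq_def)
  moreover have "measure M (\<Inter>m\<in>{k..}. A m) \<le> p" for k
    using A by (intro order_trans[OF finite_measure_mono A(2)[of k]]) auto
  ultimately show "measure M (\<Union>k. \<Inter>m\<in>{k..}. A m) \<le> p"
    by (intro LIMSEQ_le_const2) auto
qed

text \<open>Exhaustion by finite sections of \<open>E\<close>. A vector of \<open>span E\<close>
  lies in the spans of all large sections, while a point outside the limes inferior of the
  exceptional sets escapes them for arbitrarily large sections; one common index is enough.\<close>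

lemma (in prob_space) noise_bound_span:
  fixes j :: "'v::real_inner \<Rightarrow> 'y::real_inner"
  assumes noise: "noise_sequence M j \<xi>" and j: "bounded_linear j" and n: "n \<ge> 1"
    and E: "orthonormal_set E" "countable E"
    and T: "\<And>B. finite B \<Longrightarrow> B \<subseteq> E \<Longrightarrow> (\<Sum>b\<in>B. (norm (j b))\<^sup>2) \<le> T"
    and lin: "AE \<omega> in M. \<forall>i\<ge>1. linear (\<lambda>g. \<xi> i g \<omega>)"
  obtains A where "A \<in> sets M" "measure M A \<le> exp (- (r\<^sup>2 / 2))"
    "AE \<omega> in M. \<omega> \<notin> A \<longrightarrow> (\<forall>v\<in>span E. ((\<Sum>i=1..n. \<xi> i (j v) \<omega>) / sqrt n)\<^sup>2
        \<le> (2 * T + 2) * ((norm v)\<^sup>2 + r\<^sup>2 * (norm (j v))\<^sup>2))"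
proof -
  define P where "P \<omega> v \<longleftrightarrow> ((\<Sum>i=1..n. \<xi> i (j v) \<omega>) / sqrt n)\<^sup>2
        \<le> (2 * T + 2) * ((norm v)\<^sup>2 + r\<^sup>2 * (norm (j v))\<^sup>2)" for \<omega> v
  define B where "B m = {e\<in>E. to_nat_on E e < m}" for m
  have B: "finite (B m)" "B m \<subseteq> E" "orthonormal_set (B m)" for m
  proof -
    have "inj_on (to_nat_on E) (B m)"
      using inj_on_to_nat_on[OF E(2)] by (rule inj_on_subset) (auto simp: B_def)
    moreover have "to_nat_on E ` B m \<subseteq> {..<m}" by (auto simp: B_def)
    ultimately show "finite (B m)" by (metis finite_lessThan finite_subset finite_imageD)
    show "B m \<subseteq> E" by (auto simp: B_def)
    then show "orthonormal_set (B m)" using E(1) by (auto simp: orthonormal_set_def pairwise_def)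
  qed
  have "\<exists>A. A \<in> sets M \<and> measure M A \<le> exp (- (r\<^sup>2 / 2)) \<and>
      (AE \<omega> in M. \<omega> \<notin> A \<longrightarrow> (\<forall>v\<in>span (B m). P \<omega> v))" for m
    unfolding P_def
    by (rule noise_bound_finite_span[OF noise j n B(3,1) T[OF B(1,2)] lin, of r]) blast
  then have "\<forall>m. \<exists>A. A \<in> sets M \<and> measure M A \<le> exp (- (r\<^sup>2 / 2)) \<and>
      (AE \<omega> in M. \<omega> \<notin> A \<longrightarrow> (\<forall>v\<in>span (B m). P \<omega> v))" ..
  from choice[OF this] obtain A where A: "\<And>m. A m \<in> sets M"
      "\<And>m. measure M (A m) \<le> exp (- (r\<^sup>2 / 2))"
      "\<And>m. AE \<omega> in M. \<omega> \<notin> A m \<longrightarrow> (\<forall>v\<in>span (B m). P \<omega> v)"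
    by blast
  have "AE \<omega> in M. \<forall>m. \<omega> \<notin> A m \<longrightarrow> (\<forall>v\<in>span (B m). P \<omega> v)"
    using A(3) by (simp add: AE_all_countable)
  then have "AE \<omega> in M. \<omega> \<notin> (\<Union>k. \<Inter>m\<in>{k..}. A m) \<longrightarrow> (\<forall>v\<in>span E. P \<omega> v)"
  proof eventually_elim
    case (elim \<omega>)
    show ?case
    proof (intro impI ballI)
      fix v assume \<omega>: "\<omega> \<notin> (\<Union>k. \<Inter>m\<in>{k..}. A m)" and "v \<in> span E"
      then obtain t q where t: "finite t" "t \<subseteq> E" and v: "v = (\<Sum>a\<in>t. q a *\<^sub>R a)"
        unfolding span_explicit by blast
      define k where "k = Suc (Max (to_nat_on E ` t))"
      obtain m where m: "m \<ge> k" "\<omega> \<notin> A m" using \<omega> by auto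
      have "t \<subseteq> B m"
      proof
        fix e assume "e \<in> t"
        then have "to_nat_on E e \<le> Max (to_nat_on E ` t)" using t(1) by simp
        then show "e \<in> B m" using \<open>e \<in> t\<close> t(2) m(1) by (auto simp: B_def k_def)
      qed
      then have "v \<in> span (B m)"
        unfolding v by (intro span_sum span_scale span_base) auto
      then show "P \<omega> v" using elim m by blast
    qed
  qed
  then show ?thesis
    using that[of "\<Union>k. \<Inter>m\<in>{k..}. A m"] measure_eventually_le[of A, OF A(1,2)] unfolding P_def by blast
qed

text \<open>Borel--Cantelli over \<open>n\<close>, followed, for each fixed realisation, by density
  of \<open>span E\<close> in V: both sides of the bound are continuous in \<open>v\<close>.\<close>

lemma (in prob_space) noise_functional_bound:
  fixes j :: "'v::real_inner \<Rightarrow> 'y::real_inner"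
  assumes noise: "noise_sequence M j \<xi>" and inj: "inj j" and hs: "hilbert_schmidt j"
  shows "AE \<omega> in M. \<exists>C. \<forall>n\<ge>1. \<forall>v. \<bar>\<Sum>i=1..n. \<xi> i (j v) \<omega>\<bar>
    \<le> C * sqrt n * (norm v + sqrt (ln (real n + 1)) * norm (j v))"
proof -
  obtain E where j: "bounded_linear j" and Eb: "orthonormal_basis E"
    and summ: "(\<lambda>e. (norm (j e))\<^sup>2) summable_on E"
    using hs by (auto simp: hilbert_schmidt_def)
  interpret j: bounded_linear j by (rule j)
  have E: "orthonormal_set E" and dense: "closure (span E) = UNIV"
    using Eb by (auto simp: orthonormal_basis_def orthonormal_set_def)
  \<comment> \<open>A summable family has countable support, and by injectivity of \<open>j\<close>
    the support is all of \<open>E\<close>.\<close>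
  have "j e \<noteq> 0" if "e \<in> E" for e
    using that E inj j.zero by (metis injD norm_zero orthonormal_set_def zero_neq_one)
  then have "{e\<in>E. (norm (j e))\<^sup>2 \<noteq> 0} = E" by auto
  then have cE: "countable E"
    using abs_summable_countable[of "\<lambda>e. (norm (j e))\<^sup>2" E] summ by simp
  define T where "T = infsum (\<lambda>e. (norm (j e))\<^sup>2) E"
  have T: "(\<Sum>b\<in>B. (norm (j b))\<^sup>2) \<le> T" if "finite B" "B \<subseteq> E" for B
    unfolding T_def using that summ by (intro finite_sum_le_infsum) auto
  have T0: "0 \<le> T" using T[of "{}"] by simp
  note lin = noise_sequence_AE_linear[OF noise]
  have lin': "AE \<omega> in M. \<forall>i\<ge>1. linear (\<lambda>g. \<xi> i g \<omega>)"
    using lin by eventually_elim auto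
  \<comment> \<open>The factor 2 makes the failure probability
    \<open>exp (- ((r n)\<^sup>2 / 2))\<close> equal to the inverse square of \<open>n + 1\<close>,
    hence summable.\<close>
  define r where "r n = 2 * sqrt (ln (real n + 1))" for n :: nat
  define W where "W n v \<omega> = (\<Sum>i=1..n. \<xi> i (j v) \<omega>) / sqrt n" for n v \<omega>
  define P where "P n \<omega> v \<longleftrightarrow> (W n v \<omega>)\<^sup>2 \<le> (2 * T + 2) * ((norm v)\<^sup>2 + (r n)\<^sup>2 * (norm (j v))\<^sup>2)" for n \<omega> v
  have "\<exists>A. A \<in> sets M \<and> measure M A \<le> exp (- ((r (Suc n))\<^sup>2 / 2)) \<and>
      (AE \<omega> in M. \<omega> \<notin> A \<longrightarrow> (\<forall>v\<in>span E. P (Suc n) \<omega> v))" for n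
  proof -
    have "1 \<le> Suc n" by simp
    from noise_bound_span[OF noise j this E cE T lin', of "r (Suc n)"] obtain A where
      "A \<in> sets M" "measure M A \<le> exp (- ((r (Suc n))\<^sup>2 / 2))"
      "AE \<omega> in M. \<omega> \<notin> A \<longrightarrow> (\<forall>v\<in>span E. P (Suc n) \<omega> v)"
      unfolding P_def W_def .
    then show ?thesis by blast
  qed
  then have "\<forall>n. \<exists>A. A \<in> sets M \<and> measure M A \<le> exp (- ((r (Suc n))\<^sup>2 / 2)) \<and>
      (AE \<omega> in M. \<omega> \<notin> A \<longrightarrow> (\<forall>v\<in>span E. P (Suc n) \<omega> v))" ..
  from choice[OF this] obtain A where A: "\<And>n. A n \<in> sets M"
      "\<And>n. measure M (A n) \<le> exp (- ((r (Suc n))\<^sup>2 / 2))"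
      "\<And>n. AE \<omega> in M. \<omega> \<notin> A n \<longrightarrow> (\<forall>v\<in>span E. P (Suc n) \<omega> v)"
    by blast
  have "exp (- ((r (Suc n))\<^sup>2 / 2)) = inverse ((real (n + 2))\<^sup>2)" for n
  proof -
    have "- ((r (Suc n))\<^sup>2 / 2) = - ln ((real (n + 2))\<^sup>2)"
      by (simp add: r_def power_mult_distrib ln_realpow add_ac)
    then show ?thesis by (simp only: exp_minus) simp
  qed
  then have le: "measure M (A n) \<le> inverse ((real (n + 2))\<^sup>2)" for n using A(2)[of n] by metis
  have "summable (\<lambda>n. inverse ((real n)\<^sup>2))"
    by (rule inverse_power_summable) simp
  then have "summable (\<lambda>n. inverse ((real (n + 2))\<^sup>2))"
    by (rule summable_iff_shift[THEN iffD2])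
  then have "summable (\<lambda>n. measure M (A n))"
    by (rule summable_comparison_test') (simp only: real_norm_def abs_of_nonneg[OF measure_nonneg] le)
  then have "AE \<omega> in M. eventually (\<lambda>n. \<omega> \<in> space M - A n) sequentially"
    by (intro borel_cantelli_AE1 A) (auto simp: emeasure_eq_measure)
  moreover have "AE \<omega> in M. \<forall>n. \<omega> \<notin> A n \<longrightarrow> (\<forall>v\<in>span E. P (Suc n) \<omega> v)"
    using A(3) by (simp add: AE_all_countable)
  ultimately show ?thesis
    using lin
  proof eventually_elim
    case (elim \<omega>)
    obtain N where N: "\<And>n. n \<ge> N \<Longrightarrow> \<omega> \<notin> A n"
      using elim(1) by (auto simp: eventually_sequentially)
    have bl: "bounded_linear (\<lambda>v. W n v \<omega>)" for n
      unfolding W_def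
      by (rule bounded_linear_compose[OF bounded_linear_divide], rule bounded_linear_sum)
        (use elim(3) in auto)
    have P: "P n \<omega> v" if "n \<ge> Suc N" for n v
    proof -
      define k where "k = n - 1"
      have k: "n = Suc k" "k \<ge> N" using that by (auto simp: k_def)
      have "span E \<subseteq> {v. P n \<omega> v}" using elim(2) N k by auto
      moreover have "closed {v. P n \<omega> v}"
        unfolding P_def
        by (intro closed_Collect_le continuous_intros linear_continuous_on[OF bl] linear_continuous_on[OF j])
      ultimately show ?thesis using closure_minimal[of "span E"] dense by blast
    qed
    define K where "K n = onorm (\<lambda>v. W n v \<omega>)" for n
    have K0: "0 \<le> K n" for n unfolding K_def using bl by (rule onorm_pos_le)
    \<comment> \<open>The bound with \<open>2 * T + 2\<close> holds only beyond the random index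
      \<open>N\<close>; the finitely many earlier functionals are bounded on V, and their operator
      norms are added to the constant.\<close>
    define C where "C = 2 * sqrt (2 * T + 2) + (\<Sum>n\<le>N. K n)"
    have C0: "0 \<le> C" "2 * sqrt (2 * T + 2) \<le> C" using K0 T0 by (auto simp: C_def sum_nonneg)
    have "\<bar>\<Sum>i=1..n. \<xi> i (j v) \<omega>\<bar> \<le> C * sqrt n * (norm v + sqrt (ln (real n + 1)) * norm (j v))"
      if n: "n \<ge> 1" for n v
    proof -
      have l0: "0 \<le> sqrt (ln (real n + 1)) * norm (j v)" by simp
      have r0: "0 \<le> r n" by (simp add: r_def)
      have "\<bar>W n v \<omega>\<bar> \<le> C * (norm v + sqrt (ln (real n + 1)) * norm (j v))"
      proof (cases "n \<le> N")
        case True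
        then have "K n \<le> (\<Sum>n\<le>N. K n)" using K0 by (intro member_le_sum) auto
        then have "K n \<le> C" using T0 by (simp add: C_def add_increasing)
        have "\<bar>W n v \<omega>\<bar> \<le> K n * norm v" using onorm[OF bl, of n v] by (simp add: K_def)
        also have "\<dots> \<le> C * (norm v + sqrt (ln (real n + 1)) * norm (j v))"
          using \<open>K n \<le> C\<close> K0[of n] l0 by (intro mult_mono) auto
        finally show ?thesis .
      next
        case False
        then have "(W n v \<omega>)\<^sup>2 \<le> (2 * T + 2) * ((norm v)\<^sup>2 + (r n)\<^sup>2 * (norm (j v))\<^sup>2)"
          using P[of n v] by (simp add: P_def)
        also have "\<dots> \<le> (2 * T + 2) * (norm v + r n * norm (j v))\<^sup>2"
        proof (rule mult_left_mono)
          have "0 \<le> norm v * (r n * norm (j v))" using r0 by simp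
          then show "(norm v)\<^sup>2 + (r n)\<^sup>2 * (norm (j v))\<^sup>2 \<le> (norm v + r n * norm (j v))\<^sup>2"
            by (simp add: power2_sum power_mult_distrib)
        qed (use T0 in simp)
        also have "\<dots> = (sqrt (2 * T + 2) * (norm v + r n * norm (j v)))\<^sup>2"
          using T0 by (simp add: power_mult_distrib)
        finally have "\<bar>W n v \<omega>\<bar> \<le> \<bar>sqrt (2 * T + 2) * (norm v + r n * norm (j v))\<bar>"
          by (simp only: abs_le_square_iff)
        also have "\<dots> = sqrt (2 * T + 2) * (norm v + r n * norm (j v))"
          using T0 r0 by (intro abs_of_nonneg mult_nonneg_nonneg add_nonneg_nonneg) auto
        also have "\<dots> \<le> sqrt (2 * T + 2) * (2 * (norm v + sqrt (ln (real n + 1)) * norm (j v)))"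
          using T0 by (intro mult_left_mono) (simp_all add: r_def)
        also have "\<dots> = 2 * sqrt (2 * T + 2) * (norm v + sqrt (ln (real n + 1)) * norm (j v))" by simp
        also have "\<dots> \<le> C * (norm v + sqrt (ln (real n + 1)) * norm (j v))"
          using C0 l0 by (intro mult_right_mono) auto
        finally show ?thesis .
      qed
      moreover have "\<bar>\<Sum>i=1..n. \<xi> i (j v) \<omega>\<bar> = sqrt n * \<bar>W n v \<omega>\<bar>"
        using n by (simp add: W_def abs_mult)
      ultimately show ?thesis
        using mult_left_mono[of "\<bar>W n v \<omega>\<bar>" "C * (norm v + sqrt (ln (real n + 1)) * norm (j v))" "sqrt n"]
        by (simp add: mult_ac)
    qed
    then show ?case by blast
  qed
qed

subsection \<open>One Gauss--Newton step\<close>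

text \<open>Young's inequality with constant 1. The left side is the product of the three summands
  on the right raised to the powers \<open>\<theta> / 2\<close>, \<open>(1 - \<theta>) / 2\<close>
  and \<open>1 / 2\<close>. These exponents add up to 1, and each summand is at most the
  sum.\<close>

lemma powr_product_le_sum:
  fixes K p q k a \<theta> :: real
  assumes \<theta>: "0 < \<theta>" "\<theta> < 1" and pos: "0 < k" "0 < a" "0 \<le> K" "0 \<le> p" "0 \<le> q"
  shows "K * (p powr \<theta> * q powr (1 - \<theta>))
    \<le> k * p\<^sup>2 + a * q\<^sup>2 + K\<^sup>2 * (k powr (- \<theta>) * a powr (\<theta> - 1))"
proof (cases "p = 0 \<or> q = 0 \<or> K = 0")
  case True
  then show ?thesis using pos by auto
next
  case False
  then have "0 < p" "0 < q" "0 < K" using pos by auto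
  note pos = pos(1,2) this
  let ?P = "k * p\<^sup>2" and ?Q = "a * q\<^sup>2" and ?R = "K\<^sup>2 * (k powr (- \<theta>) * a powr (\<theta> - 1))"
  have R: "0 < ?P" "0 < ?Q" "0 < ?R" using pos by auto
  have "K * (p powr \<theta> * q powr (1 - \<theta>)) = ?P powr (\<theta> / 2) * ?Q powr ((1 - \<theta>) / 2) * ?R powr (1 / 2)"
  proof -
    have "ln (K * (p powr \<theta> * q powr (1 - \<theta>)))
      = ln (?P powr (\<theta> / 2) * ?Q powr ((1 - \<theta>) / 2) * ?R powr (1 / 2))"
      using pos by (simp add: ln_mult ln_powr ln_realpow) (simp add: field_simps)
    then show ?thesis using pos by (subst (asm) ln_inj_iff) auto
  qed
  also have "\<dots> \<le> (?P + ?Q + ?R) powr (\<theta> / 2) * (?P + ?Q + ?R) powr ((1 - \<theta>) / 2) * (?P + ?Q + ?R) powr (1 / 2)"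
    using R \<theta> by (intro mult_mono powr_mono2) auto
  also have "\<dots> = (?P + ?Q + ?R) powr (\<theta> / 2 + (1 - \<theta>) / 2 + 1 / 2)"
    by (simp only: powr_add)
  also have "\<theta> / 2 + (1 - \<theta>) / 2 + 1 / 2 = 1" by (simp add: field_simps)
  finally show ?thesis using R by simp
qed

lemma norm_diff_square_le:
  fixes x y :: "'a::real_inner"
  shows "(norm (x - y))\<^sup>2 \<le> 2 * (norm x)\<^sup>2 + 2 * (norm y)\<^sup>2"
proof -
  have "0 \<le> (norm (x + y))\<^sup>2" by simp
  then show ?thesis
    by (simp add: power2_norm_eq_inner inner_add_left inner_add_right inner_diff_left inner_diff_right
        inner_commute)
qed

text \<open>Up to a constant the data functional is half the squared misfit minus \<open>w\<close>,
  so minimality leaves the noise only at \<open>T (x - u\<^sub>d)\<close>. Absorbing it costs a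
  quarter of the penalty term and half of the residual term \<open>d / (2 * C)\<close>.\<close>

lemma irgn_step_estimate:
  fixes T :: "'x::real_inner \<Rightarrow> 'y::real_inner" and w :: "'y \<Rightarrow> real"
  assumes C: "1 \<le> C" and \<theta>: "0 < \<theta>" "\<theta> < 1" and \<eta>: "0 \<le> \<eta>" and a: "0 < a"
    and T: "linear T" and w: "linear w"
    and min: "data_functional (f + T (x - x')) (\<lambda>g. inner y g + w g) + a * (norm (x - u\<^sub>0))\<^sup>2
      \<le> data_functional (f + T (u\<^sub>d - x')) (\<lambda>g. inner y g + w g) + a * (norm (u\<^sub>d - u\<^sub>0))\<^sup>2"
    and tc_d: "(norm (f + T (u\<^sub>d - x') - y))\<^sup>2 \<le> \<eta> * d'"
    and tc_l: "1 / C * d - \<eta> * d' \<le> (norm (f + T (x - x') - y))\<^sup>2"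
    and tc_u: "(norm (f + T (x - x') - y))\<^sup>2 \<le> C * d + \<eta> * d'"
    and vsc: "(norm (x - u\<^sub>d))\<^sup>2 \<le> (norm (x - u\<^sub>0))\<^sup>2 - (norm (u\<^sub>d - u\<^sub>0))\<^sup>2 + \<Phi>"
    and noise: "w (T (x - u\<^sub>d)) \<le> K * (norm (T (x - u\<^sub>d)) powr \<theta> * norm (x - u\<^sub>d) powr (1 - \<theta>))
      + L * norm (T (x - u\<^sub>d))"
    and KL: "0 \<le> K" "0 \<le> d" "0 \<le> d'"
  shows "3 / 4 * a * (norm (x - u\<^sub>d))\<^sup>2 + d / (4 * C) \<le> 2 * \<eta> * d' + a * \<Phi>
    + (K\<^sup>2 * ((1 / (16 * C\<^sup>2)) powr (- \<theta>) * (a / 4) powr (\<theta> - 1)) + 4 * C\<^sup>2 * L\<^sup>2)"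
proof -
  interpret T: linear T by (rule T)
  interpret w: linear w by (rule w)
  \<comment> \<open>Both parts of the noise spend \<open>k * p\<^sup>2\<close>, and
    \<open>p\<^sup>2 \<le> 2 * C * d + 4 * \<eta> * d'\<close>; this \<open>k\<close> turns the
    total into \<open>d / (4 * C)\<close> plus at most \<open>\<eta> * d'\<close>.\<close>
  define k where "k = 1 / (16 * C\<^sup>2)"
  have k: "0 < k" using C by (simp add: k_def)
  define gx where "gx = f + T (x - x')"
  define gd where "gd = f + T (u\<^sub>d - x')"
  define p where "p = norm (T (x - u\<^sub>d))"
  define q where "q = norm (x - u\<^sub>d)"
  have df: "data_functional g (\<lambda>g. inner y g + w g) = (norm (g - y))\<^sup>2 / 2 - (norm y)\<^sup>2 / 2 - w g" for g
    by (simp add: data_functional_def power2_norm_eq_inner inner_diff_left inner_diff_right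
        inner_commute field_simps)
  have gg: "gx - gd = T (x - u\<^sub>d)" by (simp add: gx_def gd_def T.diff)
  then have wd: "w gx - w gd = w (T (x - u\<^sub>d))" by (metis w.diff)
  have "(norm (gx - y))\<^sup>2 / 2 + a * (norm (x - u\<^sub>0))\<^sup>2
      \<le> (norm (gd - y))\<^sup>2 / 2 + a * (norm (u\<^sub>d - u\<^sub>0))\<^sup>2 + w (T (x - u\<^sub>d))"
    using min wd by (simp add: df flip: gx_def gd_def)
  moreover have "a * (norm (x - u\<^sub>d))\<^sup>2 \<le> a * ((norm (x - u\<^sub>0))\<^sup>2 - (norm (u\<^sub>d - u\<^sub>0))\<^sup>2 + \<Phi>)"
    using vsc a by (intro mult_left_mono) auto
  ultimately have main: "d / (2 * C) + a * q\<^sup>2 \<le> \<eta> * d' + a * \<Phi> + w (T (x - u\<^sub>d))"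
    using tc_d tc_l C by (simp add: gx_def gd_def q_def algebra_simps)
  have "L * p \<le> k * p\<^sup>2 + 4 * C\<^sup>2 * L\<^sup>2"
  proof -
    have "0 \<le> (p / (4 * C) - 2 * C * L)\<^sup>2" by simp
    then show ?thesis using C by (simp add: k_def power2_diff power_mult_distrib power_divide mult_ac)
  qed
  moreover have "K * (p powr \<theta> * q powr (1 - \<theta>))
      \<le> k * p\<^sup>2 + a / 4 * q\<^sup>2 + K\<^sup>2 * (k powr (- \<theta>) * (a / 4) powr (\<theta> - 1))"
    using \<theta> k a KL by (intro powr_product_le_sum) (auto simp: p_def q_def)
  ultimately have wle: "w (T (x - u\<^sub>d)) \<le> 2 * k * p\<^sup>2 + a / 4 * q\<^sup>2
      + (K\<^sup>2 * (k powr (- \<theta>) * (a / 4) powr (\<theta> - 1)) + 4 * C\<^sup>2 * L\<^sup>2)"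
    using noise by (simp add: p_def q_def)
  have "p\<^sup>2 \<le> 2 * (norm (gx - y))\<^sup>2 + 2 * (norm (gd - y))\<^sup>2"
    unfolding p_def gg[symmetric] using norm_diff_square_le[of "gx - y" "gd - y"] by simp
  also have "\<dots> \<le> 2 * C * d + 4 * \<eta> * d'"
    using tc_d tc_u by (simp add: gx_def gd_def)
  finally have "2 * k * p\<^sup>2 \<le> 2 * k * (2 * C * d + 4 * \<eta> * d')"
    using k by (intro mult_left_mono) auto
  also have "\<dots> = d / (4 * C) + 8 * k * (\<eta> * d')"
    using C by (simp add: k_def field_simps power2_eq_square)
  also have "8 * k * (\<eta> * d') \<le> 1 * (\<eta> * d')"
  proof (rule mult_right_mono)
    have "1 \<le> C\<^sup>2" using C by (rule one_le_power)
    then have "1 \<le> 2 * C\<^sup>2" by simp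
    then show "8 * k \<le> 1" using C by (simp add: k_def divide_le_eq)
    show "0 \<le> \<eta> * d'" using \<eta> KL by simp
  qed
  finally have "2 * k * p\<^sup>2 \<le> d / (4 * C) + \<eta> * d'" by simp
  moreover have "d / (2 * C) = d / (4 * C) + d / (4 * C)" using C by (simp add: field_simps)
  ultimately show ?thesis
    using main wle unfolding k_def[symmetric] q_def[symmetric] by (simp add: algebra_simps)
qed

text \<open>Deterministic, for one realisation \<open>\<omega>\<close> with its random factor
  \<open>N\<close>. Both noise coefficients carry \<open>1 / sqrt n\<close> and enter the step
  estimate squared, which yields the two terms over \<open>real n\<close>; \<open>K\<close> depends
  on the path but not on \<open>n\<close>.\<close>

lemma irgn_path_estimate:
  fixes j :: "'v::real_inner \<Rightarrow> 'y::real_inner" and F :: "'x::real_inner \<Rightarrow> 'y"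
  assumes C: "1 \<le> C" and \<theta>: "0 < \<theta>" "\<theta> < 1" and C\<theta>: "1 \<le> C\<^sub>\<theta>" and \<eta>: "0 < \<eta>" and \<sigma>: "0 < \<sigma>"
    and D: "u\<^sub>d \<in> D" "u\<^sub>0 \<in> D" and deriv: "derivative_on D F F'"
    and vsc: "variational_source_condition D F u\<^sub>d u\<^sub>0 \<phi>"
    and tcc: "tangential_cone_condition D F F' (F u\<^sub>d) C \<eta>"
    and \<alpha>: "\<And>n. 0 < \<alpha> n"
    and it: "dynamic_irgn_iterates D F F' u\<^sub>0 (averaged_data (F u\<^sub>d) \<sigma> \<xi> \<omega>) \<alpha> x"
    and sm: "V_smoothing j F' u\<^sub>d \<theta> C\<^sub>\<theta> x"
    and lin: "\<And>i. i \<ge> 1 \<Longrightarrow> linear (\<lambda>g. \<xi> i g \<omega>)"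
    and noise: "\<forall>n\<ge>1. \<forall>v. \<bar>\<Sum>i=1..n. \<xi> i (j v) \<omega>\<bar>
      \<le> N * sqrt n * (norm v + sqrt (ln (real n + 1)) * norm (j v))"
  shows "\<exists>K\<ge>0. \<forall>n\<ge>1. 3 / 4 * \<alpha> n * (norm (x n - u\<^sub>d))\<^sup>2 + (norm (F (x n) - F u\<^sub>d))\<^sup>2 / (4 * C)
    \<le> 2 * \<eta> * (norm (F (x (n - 1)) - F u\<^sub>d))\<^sup>2 + \<alpha> n * \<phi> ((norm (F (x n) - F u\<^sub>d))\<^sup>2 / 2)
      + K * (\<alpha> n powr (\<theta> - 1) / real n + ln (real n + 1) / real n)"
proof -
  have xD: "x n \<in> D" for n
    using it D(2) by (cases n) (auto simp: dynamic_irgn_iterates_def)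
  define K1 where "K1 = (\<sigma> * \<bar>N\<bar> * C\<^sub>\<theta>)\<^sup>2 * ((1 / (16 * C\<^sup>2)) powr (- \<theta>) * (1 / 4) powr (\<theta> - 1))"
  define K2 where "K2 = 4 * C\<^sup>2 * (\<sigma> * \<bar>N\<bar>)\<^sup>2"
  have K: "0 \<le> K1" "0 \<le> K2" by (auto simp: K1_def K2_def)
  have "3 / 4 * \<alpha> n * (norm (x n - u\<^sub>d))\<^sup>2 + (norm (F (x n) - F u\<^sub>d))\<^sup>2 / (4 * C)
    \<le> 2 * \<eta> * (norm (F (x (n - 1)) - F u\<^sub>d))\<^sup>2 + \<alpha> n * \<phi> ((norm (F (x n) - F u\<^sub>d))\<^sup>2 / 2)
      + (K1 + K2) * (\<alpha> n powr (\<theta> - 1) / real n + ln (real n + 1) / real n)" if n: "n \<ge> 1" for n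
  proof -
    define S where "S = \<sigma> * \<bar>N\<bar> / sqrt n"
    define l where "l = sqrt (ln (real n + 1))"
    have l: "0 \<le> l" "l\<^sup>2 = ln (real n + 1)" by (auto simp: l_def)
    have S0: "0 \<le> S" using \<sigma> by (simp add: S_def)
    define w where "w g = \<sigma> / real n * (\<Sum>i=1..n. \<xi> i g \<omega>)" for g
    define T where "T = F' (x (n - 1))"
    define h where "h = x n - u\<^sub>d"
    have wlin: "linear w"
    proof -
      have "linear (\<lambda>g. \<Sum>i=1..n. \<xi> i g \<omega>)"
        by (rule linear_compose_sum) (use lin in auto)
      then show ?thesis unfolding w_def linear_iff by (simp add: algebra_simps)
    qed
    have Tlin: "linear T"
      using deriv xD by (auto simp: T_def derivative_on_def bounded_linear.linear)
    have data: "averaged_data (F u\<^sub>d) \<sigma> \<xi> \<omega> n = (\<lambda>g. inner (F u\<^sub>d) g + w g)"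
      using n by (auto simp: averaged_data_def observation_def w_def sum.distrib sum_distrib_left
          add_divide_distrib sum_divide_distrib fun_eq_iff)
    have min: "data_functional (F (x (n - 1)) + T (x n - x (n - 1))) (\<lambda>g. inner (F u\<^sub>d) g + w g)
          + \<alpha> n * (norm (x n - u\<^sub>0))\<^sup>2
        \<le> data_functional (F (x (n - 1)) + T (u\<^sub>d - x (n - 1))) (\<lambda>g. inner (F u\<^sub>d) g + w g)
          + \<alpha> n * (norm (u\<^sub>d - u\<^sub>0))\<^sup>2"
      using it n unfolding dynamic_irgn_iterates_def is_arg_min_def data[symmetric] T_def
      by (auto simp: not_less)
    have tc: "1 / C * (norm (F v - F u\<^sub>d))\<^sup>2 - \<eta> * (norm (F (x (n - 1)) - F u\<^sub>d))\<^sup>2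
          \<le> (norm (F (x (n - 1)) + T (v - x (n - 1)) - F u\<^sub>d))\<^sup>2"
        "(norm (F (x (n - 1)) + T (v - x (n - 1)) - F u\<^sub>d))\<^sup>2
          \<le> C * (norm (F v - F u\<^sub>d))\<^sup>2 + \<eta> * (norm (F (x (n - 1)) - F u\<^sub>d))\<^sup>2" if "v \<in> D" for v
      using tcc xD[of "n - 1"] that by (auto simp: tangential_cone_condition_def T_def)
    have wle: "w (T h) \<le> S * C\<^sub>\<theta> * (norm (T h) powr \<theta> * norm h powr (1 - \<theta>)) + S * l * norm (T h)"
    proof -
      \<comment> \<open>The smoothing condition puts \<open>T h\<close> into the range of
        \<open>j\<close>. Its interpolation inequality bounds \<open>norm v\<close>, whereas the
        logarithm multiplies only \<open>norm (j v) = norm (T h)\<close>.\<close>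
      define v where "v = inv j (T h)"
      have v: "j v = T h" and nv: "norm v \<le> C\<^sub>\<theta> * norm (T h) powr \<theta> * norm h powr (1 - \<theta>)"
        using sm by (auto simp: V_smoothing_def v_def T_def h_def f_inv_into_f)
      have "w (T h) \<le> \<sigma> / real n * \<bar>\<Sum>i=1..n. \<xi> i (j v) \<omega>\<bar>"
        unfolding w_def v using \<sigma> by (intro mult_left_mono) auto
      also have "\<dots> \<le> \<sigma> / real n * (\<bar>N\<bar> * sqrt n * (norm v + l * norm (j v)))"
      proof (rule mult_left_mono)
        have "\<bar>\<Sum>i=1..n. \<xi> i (j v) \<omega>\<bar> \<le> N * sqrt n * (norm v + l * norm (j v))"
          using noise n unfolding l_def by blast
        also have "\<dots> \<le> \<bar>N\<bar> * sqrt n * (norm v + l * norm (j v))"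
          using l by (intro mult_right_mono add_nonneg_nonneg) auto
        finally show "\<bar>\<Sum>i=1..n. \<xi> i (j v) \<omega>\<bar> \<le> \<bar>N\<bar> * sqrt n * (norm v + l * norm (j v))" .
      qed (use \<sigma> in auto)
      also have "\<dots> = S * (norm v + l * norm (T h))"
        using n by (simp add: S_def v real_div_sqrt field_simps flip: real_sqrt_mult)
      also have "\<dots> \<le> S * (C\<^sub>\<theta> * norm (T h) powr \<theta> * norm h powr (1 - \<theta>) + l * norm (T h))"
        using nv S0 by (intro mult_left_mono add_right_mono)
      finally show ?thesis by (simp add: algebra_simps)
    qed
    have "3 / 4 * \<alpha> n * (norm (x n - u\<^sub>d))\<^sup>2 + (norm (F (x n) - F u\<^sub>d))\<^sup>2 / (4 * C)
      \<le> 2 * \<eta> * (norm (F (x (n - 1)) - F u\<^sub>d))\<^sup>2 + \<alpha> n * \<phi> ((norm (F (x n) - F u\<^sub>d))\<^sup>2 / 2)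
      + ((S * C\<^sub>\<theta>)\<^sup>2 * ((1 / (16 * C\<^sup>2)) powr (- \<theta>) * (\<alpha> n / 4) powr (\<theta> - 1)) + 4 * C\<^sup>2 * (S * l)\<^sup>2)"
    proof (rule irgn_step_estimate[OF C \<theta> _ \<alpha> Tlin wlin min])
      show "(norm (F (x (n - 1)) + T (u\<^sub>d - x (n - 1)) - F u\<^sub>d))\<^sup>2 \<le> \<eta> * (norm (F (x (n - 1)) - F u\<^sub>d))\<^sup>2"
        using tc(2)[OF D(1)] by simp
      show "(norm (x n - u\<^sub>d))\<^sup>2 \<le> (norm (x n - u\<^sub>0))\<^sup>2 - (norm (u\<^sub>d - u\<^sub>0))\<^sup>2
          + \<phi> ((norm (F (x n) - F u\<^sub>d))\<^sup>2 / 2)"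
        using vsc xD by (simp add: variational_source_condition_def)
    qed (use \<eta> tc[OF xD] wle S0 C\<theta> in \<open>auto simp: h_def\<close>)
    also have "(S * C\<^sub>\<theta>)\<^sup>2 * ((1 / (16 * C\<^sup>2)) powr (- \<theta>) * (\<alpha> n / 4) powr (\<theta> - 1)) + 4 * C\<^sup>2 * (S * l)\<^sup>2
      = K1 * (\<alpha> n powr (\<theta> - 1) / real n) + K2 * (ln (real n + 1) / real n)"
    proof -
      have S2: "S\<^sup>2 = (\<sigma> * \<bar>N\<bar>)\<^sup>2 / real n" by (simp add: S_def power_divide)
      have "(\<alpha> n / 4) powr (\<theta> - 1) = \<alpha> n powr (\<theta> - 1) * (1 / 4) powr (\<theta> - 1)"
        using \<alpha>[of n] powr_mult[of "\<alpha> n" "1 / 4" "\<theta> - 1"] by simp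
      then have "(S * C\<^sub>\<theta>)\<^sup>2 * ((1 / (16 * C\<^sup>2)) powr (- \<theta>) * (\<alpha> n / 4) powr (\<theta> - 1))
          = K1 * (\<alpha> n powr (\<theta> - 1) / real n)"
        by (simp add: K1_def power_mult_distrib S2)
      moreover have "4 * C\<^sup>2 * (S * l)\<^sup>2 = K2 * (ln (real n + 1) / real n)"
        by (simp add: K2_def power_mult_distrib S2 l)
      ultimately show ?thesis by simp
    qed
    also have "\<dots> \<le> (K1 + K2) * (\<alpha> n powr (\<theta> - 1) / real n + ln (real n + 1) / real n)"
    proof -
      have "0 \<le> K1 * (ln (real n + 1) / real n)" "0 \<le> K2 * (\<alpha> n powr (\<theta> - 1) / real n)"
        using K by auto
      then show ?thesis by (simp add: algebra_simps add_divide_distrib)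
    qed
    finally show ?thesis by simp
  qed
  then show ?thesis using K by (intro exI[of _ "K1 + K2"]) auto
qed

subsection \<open>Convergence\<close>

lemma contraction_tendsto_zero:
  fixes x c :: "nat \<Rightarrow> real"
  assumes q: "0 \<le> q" "q < 1" and x: "\<And>n. 0 \<le> x n"
    and rec: "\<forall>\<^sub>F n in sequentially. x (Suc n) \<le> q * x n + c n" and c: "c \<longlonglongrightarrow> 0"
  shows "x \<longlonglongrightarrow> 0"
proof (rule order_tendstoI)
  fix a :: real assume "0 < a"
  \<comment> \<open>Chosen so that \<open>a / 2\<close> is the fixed point of the recursion with
    constant perturbation \<open>b\<close>.\<close>
  define b where "b = a * (1 - q) / 2"
  have "0 < b" using \<open>0 < a\<close> q by (simp add: b_def)
  then have "\<forall>\<^sub>F n in sequentially. c n < b" using c by (rule order_tendstoD(2)[rotated])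
  with rec have "\<forall>\<^sub>F n in sequentially. x (Suc n) \<le> q * x n + b"
    by eventually_elim simp
  then obtain N where N: "\<And>n. n \<ge> N \<Longrightarrow> x (Suc n) \<le> q * x n + b"
    by (auto simp: eventually_sequentially)
  have bound: "x (k + N) \<le> q ^ k * x N + a / 2" for k
  proof (induction k)
    case 0
    then show ?case using \<open>0 < a\<close> by simp
  next
    case (Suc k)
    have "x (Suc k + N) \<le> q * x (k + N) + b" using N[of "k + N"] by simp
    also have "\<dots> \<le> q * (q ^ k * x N + a / 2) + b"
      using Suc q by (intro add_right_mono mult_left_mono)
    also have "\<dots> = q ^ Suc k * x N + a / 2"
      by (simp add: b_def field_simps)
    finally show ?case .
  qed
  have "(\<lambda>k. q ^ k * x N + a / 2) \<longlonglongrightarrow> 0 * x N + a / 2"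
    using q by (intro tendsto_intros LIMSEQ_realpow_zero)
  then have "\<forall>\<^sub>F k in sequentially. q ^ k * x N + a / 2 < a"
    by (rule order_tendstoD(2)) (use \<open>0 < a\<close> in simp)
  then have "\<forall>\<^sub>F k in sequentially. x (k + N) < a"
    by eventually_elim (use bound in \<open>auto intro: le_less_trans\<close>)
  then show "\<forall>\<^sub>F n in sequentially. x n < a"
    by (subst (asm) eventually_sequentially_seg)
qed (use x in \<open>auto intro: always_eventually less_le_trans\<close>)

section \<open>Concave index functions, division by the parameter, and the size of the noise\<close>

lemma concave_scale_le:
  assumes "concave_on {0..} f" "f 0 = (0::real)" "0 \<le> l" "l \<le> 1" "0 \<le> (\<tau>::real)"
  shows "l * f \<tau> \<le> f (l * \<tau>)"
  using concave_onD[OF assms(1), of l 0 \<tau>] assms by simp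

lemma index_function_nonneg: "index_function \<phi> \<Longrightarrow> 0 \<le> \<tau> \<Longrightarrow> 0 \<le> \<phi> \<tau>"
  by (auto simp: index_function_def mono_on_def) (metis order_refl)

text \<open>Monotonicity covers \<open>\<tau> \<le> \<delta>\<close>; beyond, concavity and
  \<open>\<phi> 0 = 0\<close> make \<open>\<phi> \<tau> / \<tau>\<close> nonincreasing. The free
  point \<open>\<delta>\<close> trades the constant against the slope, an explicit substitute for
  the conjugate.\<close>

lemma index_function_affine_bound:
  assumes \<phi>: "index_function \<phi>" "concave_on {0..} \<phi>" and "0 < \<delta>" "0 \<le> \<tau>"
  shows "\<phi> \<tau> \<le> \<phi> \<delta> + \<phi> \<delta> / \<delta> * \<tau>"
proof (cases "\<tau> \<le> \<delta>")
  case True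
  then have "\<phi> \<tau> \<le> \<phi> \<delta>" using \<phi>(1) assms by (auto simp: index_function_def mono_on_def)
  moreover have "0 \<le> \<phi> \<delta> / \<delta> * \<tau>" using index_function_nonneg[OF \<phi>(1)] assms by simp
  ultimately show ?thesis by linarith
next
  case False
  then have "\<delta> / \<tau> * \<phi> \<tau> \<le> \<phi> (\<delta> / \<tau> * \<tau>)"
    using \<phi> assms by (intro concave_scale_le) (auto simp: index_function_def)
  then have "\<phi> \<tau> \<le> \<phi> \<delta> / \<delta> * \<tau>" using False assms by (simp add: field_simps)
  then show ?thesis using index_function_nonneg[OF \<phi>(1), of \<delta>] assms by linarith
qed

lemma ln_Suc_le_powr:
  assumes "0 < p"
  obtains B where "0 \<le> B" "\<And>n. n \<ge> 1 \<Longrightarrow> ln (real n + 1) \<le> B * real n powr p"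
proof
  show "0 \<le> 2 powr p / p" using assms by simp
  fix n :: nat assume n: "n \<ge> 1"
  have "ln (real n + 1) \<le> (real n + 1) powr p / p" using n assms by (intro ln_powr_bound) auto
  also have "\<dots> \<le> (2 * real n) powr p / p"
    using n assms by (intro divide_right_mono powr_mono2) auto
  also have "\<dots> = 2 powr p / p * real n powr p" by (simp add: powr_mult)
  finally show "ln (real n + 1) \<le> 2 powr p / p * real n powr p" .
qed

text \<open>The contracting quantity is \<open>d / a\<close>, not \<open>d\<close>: passing from
  \<open>d' / a\<close> to \<open>d' / a'\<close> costs the ratio \<open>r\<close>, which a small
  \<open>\<eta>\<close> compensates. The remaining terms, divided by \<open>a\<close>, are collected
  in \<open>c\<close>.\<close>

lemma step_divided_by_parameter:
  fixes a a' c d d' e C \<eta> r :: real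
  assumes "0 < a" "0 < a'" "a' / a \<le> r" "0 \<le> \<eta>" "0 \<le> d'" "0 \<le> d" "0 \<le> e" "1 \<le> C"
    and est: "3 / 4 * a * e + d / (8 * C) \<le> 2 * \<eta> * d' + a * c"
  shows "d / a \<le> 16 * C * \<eta> * r * (d' / a') + 8 * C * c"
    and "e \<le> 4 / 3 * (2 * \<eta> * r * (d' / a') + c)"
proof -
  have "2 * \<eta> * d' = a * (2 * \<eta> * (d' / a') * (a' / a))" using assms by simp
  also have "\<dots> \<le> a * (2 * \<eta> * (d' / a') * r)" using assms by (intro mult_left_mono) auto
  finally have le: "3 / 4 * a * e + d / (8 * C) \<le> a * (2 * \<eta> * r * (d' / a') + c)"
    using est by (simp add: algebra_simps)
  have *: "3 / 4 * e + d / a / (8 * C) \<le> 2 * \<eta> * r * (d' / a') + c"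
  proof -
    have "a * (3 / 4 * e + d / a / (8 * C)) = 3 / 4 * a * e + d / (8 * C)"
      using assms(1) by (simp add: distrib_left)
    then show ?thesis
      using le mult_le_cancel_left_pos[OF assms(1)] by metis
  qed
  have "0 \<le> d / a / (8 * C)" using assms by simp
  with * have "3 / 4 * e \<le> 2 * \<eta> * r * (d' / a') + c" by linarith
  from mult_left_mono[OF this, of "4 / 3"] show "e \<le> 4 / 3 * (2 * \<eta> * r * (d' / a') + c)" by simp
  have "d / a / (8 * C) \<le> 2 * \<eta> * r * (d' / a') + c" using * assms by simp
  then have "d / a \<le> (2 * \<eta> * r * (d' / a') + c) * (8 * C)"
    using assms by (simp only: divide_le_eq) simp
  then show "d / a \<le> 16 * C * \<eta> * r * (d' / a') + 8 * C * c" by (simp add: algebra_simps)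
qed

lemma powr_pred_divide:
  fixes a :: real
  assumes "0 < a"
  shows "a powr (\<theta> - 1) / a = 1 / a powr (2 - \<theta>)"
proof -
  have "a powr (\<theta> - 1) / a = a powr (\<theta> - 1 - 1)"
    unfolding powr_diff[of _ "\<theta> - 1" 1] using assms by simp
  also have "\<dots> = inverse (a powr (2 - \<theta>))" by (simp add: powr_minus[symmetric])
  finally show ?thesis by (simp add: inverse_eq_divide)
qed

text \<open>Eventually \<open>n * \<alpha> n powr (2 - \<theta>) \<ge> 1\<close>, so
  \<open>\<alpha> n\<close> is at least \<open>n powr (- (1 / (2 - \<theta>)))\<close>. Hence
  \<open>n * \<alpha> n\<close> grows at least like the positive power
  \<open>(1 - \<theta>) / (2 - \<theta>)\<close> of \<open>n\<close> and beats the
  logarithm.\<close>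

lemma noise_level_tendsto_zero:
  fixes \<alpha> :: "nat \<Rightarrow> real"
  assumes \<theta>: "0 < \<theta>" "\<theta> < 1" and \<alpha>: "\<And>n. 0 < \<alpha> n"
    and lim: "filterlim (\<lambda>n. real n * \<alpha> n powr (2 - \<theta>)) at_top sequentially"
  shows "(\<lambda>n. (\<alpha> n powr (\<theta> - 1) / real n + ln (real n + 1) / real n) / \<alpha> n) \<longlonglongrightarrow> 0"
proof -
  have 1: "\<alpha> n powr (\<theta> - 1) / real n / \<alpha> n = inverse (real n * \<alpha> n powr (2 - \<theta>))" for n
  proof -
    have "\<alpha> n powr (\<theta> - 1) / real n / \<alpha> n = \<alpha> n powr (\<theta> - 1) / \<alpha> n / real n"
      by (simp only: divide_divide_eq_left mult.commute)
    then show ?thesis using powr_pred_divide[OF \<alpha>[of n]] by (simp add: field_simps)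
  qed
  have lim1: "(\<lambda>n. \<alpha> n powr (\<theta> - 1) / real n / \<alpha> n) \<longlonglongrightarrow> 0"
    unfolding 1 using tendsto_inverse_0_at_top[OF lim] .
  \<comment> \<open>Half the growth exponent of \<open>n * \<alpha> n\<close>: one half dominates
    the logarithm, the other forces decay.\<close>
  define p where "p = (1 - \<theta>) / (2 * (2 - \<theta>))"
  have p: "0 < p" using \<theta> by (simp add: p_def)
  obtain B where B: "0 \<le> B" "\<And>n. n \<ge> 1 \<Longrightarrow> ln (real n + 1) \<le> B * real n powr p"
    using ln_Suc_le_powr[OF p] by blast
  have "\<forall>\<^sub>F n in sequentially. 1 \<le> real n * \<alpha> n powr (2 - \<theta>)"
    using lim by (simp add: filterlim_at_top)
  then have le: "\<forall>\<^sub>F n in sequentially. ln (real n + 1) / real n / \<alpha> n \<le> B * real n powr (- p)"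
    using eventually_ge_at_top[of 1]
  proof eventually_elim
    case (elim n)
    then have n: "0 < real n" by simp
    have "real n powr (- 1) \<le> \<alpha> n powr (2 - \<theta>)"
      using elim n by (simp add: powr_minus field_simps)
    then have "(real n powr (- 1)) powr (1 / (2 - \<theta>)) \<le> (\<alpha> n powr (2 - \<theta>)) powr (1 / (2 - \<theta>))"
      using \<theta> by (intro powr_mono2) auto
    moreover have "(\<alpha> n powr (2 - \<theta>)) powr (1 / (2 - \<theta>)) = \<alpha> n"
      using \<theta> \<alpha>[of n] by (simp add: powr_powr)
    moreover have "(real n powr (- 1)) powr (1 / (2 - \<theta>)) = real n powr (- (1 / (2 - \<theta>)))"
      by (subst powr_powr) simp
    ultimately have "real n powr (- (1 / (2 - \<theta>))) \<le> \<alpha> n" by simp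
    then have "real n * real n powr (- (1 / (2 - \<theta>))) \<le> real n * \<alpha> n"
      by (intro mult_left_mono) auto
    moreover have "real n * real n powr (- (1 / (2 - \<theta>))) = real n powr (2 * p)"
    proof -
      have "1 + - (1 / (2 - \<theta>)) = 2 * p" using \<theta> by (simp add: p_def field_simps)
      then show ?thesis using n powr_add[of "real n" 1 "- (1 / (2 - \<theta>))"] by simp
    qed
    ultimately have na: "real n powr (2 * p) \<le> real n * \<alpha> n" by simp
    have "ln (real n + 1) / (real n * \<alpha> n) \<le> (B * real n powr p) / (real n * \<alpha> n)"
      using B elim \<alpha>[of n] by (intro divide_right_mono) auto
    also have "\<dots> \<le> (B * real n powr p) / real n powr (2 * p)"
      using na B n \<alpha>[of n] by (intro divide_left_mono) auto
    also have "\<dots> = B * real n powr (- p)"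
      using powr_diff[of "real n" p "2 * p"] by simp
    finally show ?case by simp
  qed
  have "(\<lambda>n. B * real n powr (- p)) \<longlonglongrightarrow> B * 0"
    by (intro tendsto_intros tendsto_neg_powr filterlim_real_sequentially) (use p in simp)
  then have "(\<lambda>n. ln (real n + 1) / real n / \<alpha> n) \<longlonglongrightarrow> 0"
    using \<alpha> by (intro tendsto_sandwich[OF _ le tendsto_const]) (auto intro!: always_eventually simp: less_imp_le)
  from tendsto_add[OF lim1 this] show ?thesis by (simp add: add_divide_distrib)
qed

text \<open>If the parameter more than halved, its power \<open>2 - \<theta> \<ge> 1\<close> would
  too, which the growth from \<open>n\<close> to \<open>n + 1 \<le> 2 * n\<close> cannot
  compensate.\<close>

lemma parameter_ratio_le_2:
  fixes \<alpha> :: "nat \<Rightarrow> real"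
  assumes \<theta>: "0 < \<theta>" "\<theta> < 1" and \<alpha>: "\<And>n. 0 < \<alpha> n"
    and inc: "incseq (\<lambda>n. real n * \<alpha> n powr (2 - \<theta>))" and n: "n \<ge> 1"
  shows "\<alpha> n / \<alpha> (Suc n) \<le> 2"
proof (rule ccontr)
  assume "\<not> ?thesis"
  then have "2 * \<alpha> (Suc n) < \<alpha> n" using \<alpha>[of "Suc n"] by (simp add: field_simps)
  then have "(2 * \<alpha> (Suc n)) powr (2 - \<theta>) < \<alpha> n powr (2 - \<theta>)"
    using \<theta> \<alpha>[of "Suc n"] by (intro powr_less_mono2) auto
  then have "2 powr (2 - \<theta>) * \<alpha> (Suc n) powr (2 - \<theta>) < \<alpha> n powr (2 - \<theta>)"
    using \<alpha>[of "Suc n"] by (simp add: powr_mult)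
  moreover have "2 powr 1 \<le> 2 powr (2 - \<theta>)" using \<theta> by (intro powr_mono) auto
  then have "2 * \<alpha> (Suc n) powr (2 - \<theta>) \<le> 2 powr (2 - \<theta>) * \<alpha> (Suc n) powr (2 - \<theta>)"
    by (intro mult_right_mono) auto
  ultimately have "real n * (2 * \<alpha> (Suc n) powr (2 - \<theta>)) < real n * \<alpha> n powr (2 - \<theta>)"
    using n by (intro mult_strict_left_mono) auto
  also have "\<dots> \<le> real (Suc n) * \<alpha> (Suc n) powr (2 - \<theta>)"
    using incseqD[OF inc, of n "Suc n"] by simp
  finally have "(real n - 1) * \<alpha> (Suc n) powr (2 - \<theta>) < 0" by (simp add: algebra_simps)
  then show False using n \<alpha>[of "Suc n"] by (simp add: mult_less_0_iff)
qed

text \<open>The affine bound at \<open>\<delta> = sqrt (\<alpha> n)\<close> makes both parts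
  negligible: the constant \<open>\<phi> (sqrt (\<alpha> n))\<close> tends to 0 by continuity, and
  \<open>\<alpha> n\<close> times the slope is
  \<open>sqrt (\<alpha> n) * \<phi> (sqrt (\<alpha> n))\<close>, eventually absorbed by half of the
  residual term.\<close>

lemma irgn_error_tendsto_zero:
  fixes \<alpha> d e :: "nat \<Rightarrow> real"
  assumes C: "1 \<le> C" and \<theta>: "0 < \<theta>" "\<theta> < 1" and \<eta>: "0 \<le> \<eta>" "\<eta> \<le> 1 / (64 * C)"
    and \<alpha>: "\<And>n. 0 < \<alpha> n" "\<alpha> \<longlonglongrightarrow> 0"
    and inc: "incseq (\<lambda>n. real n * \<alpha> n powr (2 - \<theta>))"
    and lim: "filterlim (\<lambda>n. real n * \<alpha> n powr (2 - \<theta>)) at_top sequentially"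
    and \<phi>: "index_function \<phi>" "concave_on {0..} \<phi>"
    and nonneg: "\<And>n. 0 \<le> d n" "\<And>n. 0 \<le> e n"
    and est: "\<And>n. n \<ge> 1 \<Longrightarrow> 3 / 4 * \<alpha> n * e n + d n / (4 * C)
      \<le> 2 * \<eta> * d (n - 1) + \<alpha> n * \<phi> (d n / 2)
        + K * (\<alpha> n powr (\<theta> - 1) / real n + ln (real n + 1) / real n)"
  shows "e \<longlonglongrightarrow> 0"
proof -
  define b where "b n = \<phi> (sqrt (\<alpha> n))" for n
  define c where "c n = b n + K * ((\<alpha> n powr (\<theta> - 1) / real n + ln (real n + 1) / real n) / \<alpha> n)" for n
  have sq: "(\<lambda>n. sqrt (\<alpha> n)) \<longlonglongrightarrow> 0" using tendsto_real_sqrt[OF \<alpha>(2)] by simp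
  have b: "b \<longlonglongrightarrow> 0"
  proof -
    have "(\<lambda>n. \<phi> (sqrt (\<alpha> n))) \<longlonglongrightarrow> \<phi> 0"
      using \<phi>(1) \<alpha>(1) unfolding index_function_def
      by (intro continuous_on_tendsto_compose[OF _ sq, of "{0..}"]) (auto intro!: always_eventually simp: less_imp_le)
    then show ?thesis using \<phi>(1) by (simp add: index_function_def b_def[abs_def])
  qed
  have c: "c \<longlonglongrightarrow> 0"
    using tendsto_add[OF b tendsto_mult_left[OF noise_level_tendsto_zero[OF \<theta> \<alpha>(1) lim], of K]]
    by (simp add: c_def[abs_def])
  have c': "(\<lambda>n. c (Suc n)) \<longlonglongrightarrow> 0" using c by (rule LIMSEQ_Suc)
  define \<delta> where "\<delta> n = d n / \<alpha> n" for n
  have \<delta>0: "0 \<le> \<delta> n" for n using nonneg \<alpha>(1)[of n] by (simp add: \<delta>_def)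
  have "(\<lambda>n. b n * sqrt (\<alpha> n)) \<longlonglongrightarrow> 0 * 0" by (intro tendsto_mult b sq)
  then have "\<forall>\<^sub>F n in sequentially. b n * sqrt (\<alpha> n) < 1 / (4 * C)"
    by (rule order_tendstoD(2)) (use C in simp)
  then have small: "\<forall>\<^sub>F n in sequentially. b (Suc n) * sqrt (\<alpha> (Suc n)) < 1 / (4 * C)"
    by (subst eventually_sequentially_Suc)
  have steps: "\<forall>\<^sub>F n in sequentially. \<delta> (Suc n) \<le> 1 / 2 * \<delta> n + 8 * C * c (Suc n) \<and>
      e (Suc n) \<le> 4 / 3 * (4 * \<eta> * \<delta> n + c (Suc n))"
    using small eventually_ge_at_top[of 1]
  proof eventually_elim
    case (elim n)
    let ?m = "Suc n"
    have "\<alpha> ?m * \<phi> (d ?m / 2) \<le> \<alpha> ?m * (b ?m + b ?m / sqrt (\<alpha> ?m) * (d ?m / 2))"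
      unfolding b_def using \<alpha>(1)[of ?m] nonneg(1)[of ?m] \<phi>
      by (intro mult_left_mono index_function_affine_bound) auto
    also have "\<dots> = \<alpha> ?m * b ?m + b ?m * (\<alpha> ?m / sqrt (\<alpha> ?m)) * (d ?m / 2)"
      by (simp add: algebra_simps)
    also have "\<alpha> ?m / sqrt (\<alpha> ?m) = sqrt (\<alpha> ?m)" using \<alpha>(1)[of ?m] by (simp add: real_div_sqrt)
    also have "b ?m * sqrt (\<alpha> ?m) * (d ?m / 2) \<le> 1 / (4 * C) * (d ?m / 2)"
      using elim(1) nonneg(1)[of ?m] by (intro mult_right_mono) auto
    finally have ph: "\<alpha> ?m * \<phi> (d ?m / 2) \<le> \<alpha> ?m * b ?m + d ?m / (8 * C)" by simp
    have "\<alpha> ?m * c ?m = \<alpha> ?m * b ?m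
        + K * (\<alpha> ?m powr (\<theta> - 1) / real ?m + ln (real ?m + 1) / real ?m)"
    proof -
      have "\<alpha> ?m * (K * (z / \<alpha> ?m)) = K * z" for z using \<alpha>(1)[of ?m] by simp
      then show ?thesis by (simp only: c_def distrib_left[of "\<alpha> ?m" "b ?m"])
    qed
    moreover have "d ?m / (4 * C) = d ?m / (8 * C) + d ?m / (8 * C)" using C by simp
    ultimately have "3 / 4 * \<alpha> ?m * e ?m + d ?m / (8 * C) \<le> 2 * \<eta> * d n + \<alpha> ?m * c ?m"
      using est[of ?m] ph by simp
    note step = step_divided_by_parameter[OF \<alpha>(1) \<alpha>(1) parameter_ratio_le_2[OF \<theta> \<alpha>(1) inc elim(2)]
        \<eta>(1) nonneg(1) nonneg(1) nonneg(2) C this]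
    have "16 * C * \<eta> * 2 \<le> 1 / 2" using \<eta> C by (simp add: field_simps)
    then have "16 * C * \<eta> * 2 * \<delta> n \<le> 1 / 2 * \<delta> n" using \<delta>0 by (rule mult_right_mono)
    then show ?case using step by (simp add: \<delta>_def)
  qed
  have "(\<lambda>n. 8 * C * c (Suc n)) \<longlonglongrightarrow> 0" using tendsto_mult_left[OF c', of "8 * C"] by simp
  then have \<delta>: "\<delta> \<longlonglongrightarrow> 0"
    using steps by (intro contraction_tendsto_zero[of "1 / 2" \<delta> "\<lambda>n. 8 * C * c (Suc n)"] \<delta>0)
      (auto elim: eventually_mono)
  have "(\<lambda>n. 4 / 3 * (4 * \<eta> * \<delta> n + c (Suc n))) \<longlonglongrightarrow> 4 / 3 * (4 * \<eta> * 0 + 0)"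
    by (intro tendsto_intros \<delta> c')
  then have "(\<lambda>n. e (Suc n)) \<longlonglongrightarrow> 0"
    using nonneg(2) steps
    by (intro tendsto_sandwich[of "\<lambda>_. 0" "\<lambda>n. e (Suc n)" _ "\<lambda>n. 4 / 3 * (4 * \<eta> * \<delta> n + c (Suc n))"])
      (auto elim: eventually_mono intro: always_eventually)
  then show ?thesis by (rule LIMSEQ_imp_Suc)
qed

subsection \<open>Rates\<close>

text \<open>\<open>Psi\<close> in the variable \<open>s = t powr (1 / (2 - \<theta>))\<close>. At
  the prescribed minimiser \<open>s\<close> is \<open>1 / \<alpha> n\<close>, the slope at which the
  step estimate meets \<open>\<phi>\<close>.\<close>

definition index_conjugate :: "(real \<Rightarrow> real) \<Rightarrow> real \<Rightarrow> real" where
  "index_conjugate \<phi> s = fenchel_conjugate {0..} (\<lambda>\<tau>. - \<phi> \<tau>) (- s)"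

lemma Psi_eq_index_conjugate: "Psi \<theta> \<phi> t = index_conjugate \<phi> (t powr (1 / (2 - \<theta>)))"
  by (simp add: Psi_def index_conjugate_def)

lemma index_conjugate_eq: "index_conjugate \<phi> s = (SUP \<tau>\<in>{0..}. \<phi> \<tau> - s * \<tau>)"
  by (simp add: index_conjugate_def fenchel_conjugate_def algebra_simps)

section \<open>Consequences of saturation, and the rate\<close>

context
  fixes \<phi> :: "real \<Rightarrow> real" and \<epsilon> :: real
  assumes \<phi>: "index_function \<phi>" "concave_on {0..} \<phi>"
    and \<epsilon>: "0 < \<epsilon>" and sat: "concave_on {0..} (\<lambda>\<tau>. \<phi> \<tau> powr (1 + \<epsilon>))"
begin

text \<open>A concave function vanishing at 0 grows at most linearly under dilation; applied to
  \<open>\<phi> \<tau> powr (1 + \<epsilon>)\<close> this gives sublinear growth of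
  \<open>\<phi>\<close> after taking roots.\<close>

lemma saturated_scaling:
  assumes "1 \<le> c" "0 \<le> \<tau>"
  shows "\<phi> (c * \<tau>) \<le> c powr (1 / (1 + \<epsilon>)) * \<phi> \<tau>"
proof -
  have 0: "0 \<le> \<phi> (c * \<tau>)" "0 \<le> \<phi> \<tau>" using index_function_nonneg[OF \<phi>(1)] assms by auto
  have "1 / c * \<phi> (c * \<tau>) powr (1 + \<epsilon>) \<le> \<phi> (1 / c * (c * \<tau>)) powr (1 + \<epsilon>)"
    using sat \<phi>(1) assms by (intro concave_scale_le) (auto simp: index_function_def)
  then have "\<phi> (c * \<tau>) powr (1 + \<epsilon>) \<le> c * \<phi> \<tau> powr (1 + \<epsilon>)"
    using assms by (simp add: field_simps)
  then have "(\<phi> (c * \<tau>) powr (1 + \<epsilon>)) powr (1 / (1 + \<epsilon>)) \<le> (c * \<phi> \<tau> powr (1 + \<epsilon>)) powr (1 / (1 + \<epsilon>))"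
    using \<epsilon> by (intro powr_mono2) auto
  then show ?thesis using \<epsilon> 0 assms by (simp add: powr_powr powr_mult)
qed

text \<open>By saturation the chord slope \<open>\<phi> \<delta> / \<delta>\<close> tends to 0, so
  some \<open>\<delta>\<close> brings it below \<open>s\<close>; the affine bound at this point then
  bounds the supremum by \<open>\<phi> \<delta>\<close>.\<close>

lemma bdd_above_index_conjugate:
  assumes "0 < s"
  shows "bdd_above ((\<lambda>\<tau>. \<phi> \<tau> - s * \<tau>) ` {0..})"
proof -
  define p where "p = \<epsilon> / (1 + \<epsilon>)"
  have p: "0 < p" "1 / (1 + \<epsilon>) - 1 = - p" using \<epsilon> by (auto simp: p_def field_simps)
  have "((\<lambda>\<delta>. \<phi> 1 * \<delta> powr (- p)) \<longlongrightarrow> \<phi> 1 * 0) at_top"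
    by (intro tendsto_intros tendsto_neg_powr filterlim_ident) (use p(1) in simp)
  then have "\<forall>\<^sub>F \<delta> in at_top. \<phi> 1 * \<delta> powr (- p) < s"
    by (rule order_tendstoD(2)) (use assms in simp)
  then obtain \<delta> where \<delta>: "1 \<le> \<delta>" "\<phi> 1 * \<delta> powr (- p) < s"
    using eventually_ge_at_top[of "1::real"] eventually_happens[OF eventually_conj] trivial_limit_at_top_linorder
    by (metis (no_types, lifting))
  have "\<phi> \<delta> \<le> \<delta> powr (1 / (1 + \<epsilon>)) * \<phi> 1" using saturated_scaling[of \<delta> 1] \<delta> by simp
  then have "\<phi> \<delta> / \<delta> \<le> \<delta> powr (1 / (1 + \<epsilon>)) * \<phi> 1 / \<delta>" using \<delta> by (intro divide_right_mono) auto
  also have "\<dots> = \<phi> 1 * \<delta> powr (1 / (1 + \<epsilon>) - 1)" using \<delta> by (simp add: powr_diff)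
  finally have slope: "\<phi> \<delta> / \<delta> \<le> s" using \<delta> p by simp
  have "\<phi> \<tau> - s * \<tau> \<le> \<phi> \<delta>" if "0 \<le> \<tau>" for \<tau>
  proof -
    have "\<phi> \<tau> \<le> \<phi> \<delta> + \<phi> \<delta> / \<delta> * \<tau>" using \<delta> that \<phi> by (intro index_function_affine_bound) auto
    also have "\<phi> \<delta> / \<delta> * \<tau> \<le> s * \<tau>" using slope that by (rule mult_right_mono)
    finally show ?thesis by simp
  qed
  then show ?thesis by (intro bdd_aboveI2) auto
qed

lemma index_conjugate_upper: "0 < s \<Longrightarrow> 0 \<le> \<tau> \<Longrightarrow> \<phi> \<tau> \<le> index_conjugate \<phi> s + s * \<tau>"
  using cSUP_upper[OF _ bdd_above_index_conjugate, of \<tau> s] by (simp add: index_conjugate_eq)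

lemma index_conjugate_nonneg: "0 < s \<Longrightarrow> 0 \<le> index_conjugate \<phi> s"
  using index_conjugate_upper[of s 0] \<phi>(1) by (simp add: index_function_def)

text \<open>Flattening the slope costs only a power of the factor. It serves to absorb
  \<open>\<phi>\<close> with a constant multiple of \<open>\<alpha> n\<close> and to bound the
  conjugate at \<open>1 / \<alpha> n\<close> from below.\<close>

lemma index_conjugate_scaling:
  assumes "1 \<le> L" "0 < s"
  shows "index_conjugate \<phi> (s / L) \<le> L powr (1 / \<epsilon>) * index_conjugate \<phi> s"
  unfolding index_conjugate_eq[of \<phi> "s / L"]
proof (rule cSUP_least)
  fix \<tau> :: real assume "\<tau> \<in> {0..}"
  \<comment> \<open>The dilation for which the growth factor
    \<open>c powr (1 / (1 + \<epsilon>))\<close> of \<open>\<phi>\<close> equals the factor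
    \<open>c / L\<close> of the linear term; both are
    \<open>L powr (1 / \<epsilon>)\<close>.\<close>
  define c where "c = L powr ((1 + \<epsilon>) / \<epsilon>)"
  have c: "1 \<le> c" using assms \<epsilon> by (simp add: c_def ge_one_powr_ge_zero)
  have cp: "c powr (1 / (1 + \<epsilon>)) = L powr (1 / \<epsilon>)"
    using \<epsilon> by (simp add: c_def powr_powr)
  have cL: "c / L = L powr (1 / \<epsilon>)"
  proof -
    have "(1 + \<epsilon>) / \<epsilon> - 1 = 1 / \<epsilon>" using \<epsilon> by (simp add: field_simps)
    then show ?thesis using assms powr_diff[of L "(1 + \<epsilon>) / \<epsilon>" 1] by (simp add: c_def)
  qed
  define \<tau>' where "\<tau>' = \<tau> / c"
  have \<tau>': "0 \<le> \<tau>'" "\<tau> = c * \<tau>'" using \<open>\<tau> \<in> {0..}\<close> c by (auto simp: \<tau>'_def)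
  have "\<phi> \<tau> \<le> L powr (1 / \<epsilon>) * \<phi> \<tau>'"
    using saturated_scaling[OF c \<tau>'(1)] by (simp add: \<tau>'(2) cp)
  moreover have "s / L * \<tau> = L powr (1 / \<epsilon>) * (s * \<tau>')"
    by (simp add: \<tau>'(2) flip: cL)
  ultimately have "\<phi> \<tau> - s / L * \<tau> \<le> L powr (1 / \<epsilon>) * (\<phi> \<tau>' - s * \<tau>')"
    by (simp add: algebra_simps)
  also have "\<dots> \<le> L powr (1 / \<epsilon>) * index_conjugate \<phi> s"
    using index_conjugate_upper[OF assms(2) \<tau>'(1)] by (intro mult_left_mono) auto
  finally show "\<phi> \<tau> - s / L * \<tau> \<le> L powr (1 / \<epsilon>) * index_conjugate \<phi> s" .
qed simp

text \<open>If the conjugate vanished at 1, scaling would make it vanish at every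
  \<open>1 / L\<close>, forcing \<open>\<phi> 1 \<le> 1 / L\<close> for all
  \<open>L \<ge> 1\<close>.\<close>

lemma index_conjugate_pos:
  assumes "0 < \<phi> 1"
  shows "0 < index_conjugate \<phi> 1"
proof (rule ccontr)
  assume "\<not> ?thesis"
  then have 0: "index_conjugate \<phi> 1 = 0" using index_conjugate_nonneg[of 1] by simp
  define L where "L = max 1 (2 / \<phi> 1)"
  have L: "1 \<le> L" "2 / \<phi> 1 \<le> L" by (auto simp: L_def)
  have "\<phi> 1 \<le> index_conjugate \<phi> (1 / L) + 1 / L * 1"
    using L by (intro index_conjugate_upper) auto
  also have "\<dots> \<le> 1 / L" using index_conjugate_scaling[OF L(1), of 1] 0 by simp
  also have "\<dots> \<le> \<phi> 1 / 2" using L assms by (simp add: field_simps)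
  finally show False using assms by simp
qed

text \<open>Since \<open>\<eta>\<close> must not depend on \<open>\<epsilon>\<close>, the contraction argument needs a bound for \<open>R (n - 1) / R n\<close>
  which is uniform in \<open>\<phi>\<close>; it is obtained from inserting the minimiser for \<open>n\<close> at \<open>n - 1\<close>.\<close>

lemma irgn_error_rate:
  fixes \<alpha> d e :: "nat \<Rightarrow> real"
  assumes C: "1 \<le> C" and \<theta>: "0 < \<theta>" "\<theta> < 1" and \<sigma>: "0 < \<sigma>"
    and Cd: "1 \<le> Cd" and \<eta>: "0 \<le> \<eta>" "\<eta> \<le> 1 / (64 * C * Cd)"
    and \<alpha>: "\<And>n. 0 < \<alpha> n" "\<And>n. \<alpha> n \<le> 1" "\<And>n. \<alpha> n / \<alpha> (Suc n) \<le> Cd"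
    and opt: "\<forall>n\<ge>1. is_arg_min (\<lambda>t. Psi \<theta> \<phi> t + \<sigma>\<^sup>2 / real n * t) (\<lambda>t. 0 < t)
                 (1 / \<alpha> n powr (2 - \<theta>))"
    and nonneg: "\<And>n. 0 \<le> d n" "\<And>n. 0 \<le> e n" and K: "0 \<le> K"
    and est: "\<And>n. n \<ge> 1 \<Longrightarrow> 3 / 4 * \<alpha> n * e n + d n / (4 * C)
      \<le> 2 * \<eta> * d (n - 1) + \<alpha> n * \<phi> (d n / 2)
        + K * (\<alpha> n powr (\<theta> - 1) / real n + ln (real n + 1) / real n)"
  shows "e \<in> O(\<lambda>n. R_rate \<theta> \<phi> (\<sigma>\<^sup>2 / real n))"
proof -
  define R where "R n = R_rate \<theta> \<phi> (\<sigma>\<^sup>2 / real n)" for n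
  define t where "t n = 1 / \<alpha> n powr (2 - \<theta>)" for n
  have t0: "0 < t n" for n using \<alpha>(1)[of n] by (simp add: t_def)
  have Psi_nonneg: "0 \<le> Psi \<theta> \<phi> s" if "0 < s" for s
    unfolding Psi_eq_index_conjugate using that by (intro index_conjugate_nonneg) auto
  have tpow: "t n powr (1 / (2 - \<theta>)) = 1 / \<alpha> n" for n
    using \<alpha>(1)[of n] \<theta> by (simp add: t_def powr_divide powr_powr)
  have min: "Psi \<theta> \<phi> (t n) + \<sigma>\<^sup>2 / real n * t n \<le> Psi \<theta> \<phi> s + \<sigma>\<^sup>2 / real n * s"
    if "n \<ge> 1" "0 < s" for n s
    proof -
    have "\<not> Psi \<theta> \<phi> s + \<sigma>\<^sup>2 / real n * s < Psi \<theta> \<phi> (t n) + \<sigma>\<^sup>2 / real n * t n"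
      using opt that unfolding is_arg_min_def t_def by blast
    then show ?thesis by (simp only: not_less)
  qed
  have R_le: "R n \<le> Psi \<theta> \<phi> s + \<sigma>\<^sup>2 / real n * s" if "0 < s" for n s
    unfolding R_def R_rate_def
    by (intro cINF_lower bdd_belowI2[of _ 0]) (use that Psi_nonneg in \<open>auto intro!: add_nonneg_nonneg\<close>)
  have R_eq: "R n = index_conjugate \<phi> (1 / \<alpha> n) + \<sigma>\<^sup>2 / real n * t n" if "n \<ge> 1" for n
  proof (rule antisym)
    show "R n \<le> index_conjugate \<phi> (1 / \<alpha> n) + \<sigma>\<^sup>2 / real n * t n"
      using R_le[OF t0, of n n] by (simp add: Psi_eq_index_conjugate tpow)
    show "index_conjugate \<phi> (1 / \<alpha> n) + \<sigma>\<^sup>2 / real n * t n \<le> R n"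
      unfolding R_def R_rate_def
      using min[OF that] by (intro cINF_greatest) (auto simp: Psi_eq_index_conjugate tpow)
  qed
  have conj0: "0 \<le> index_conjugate \<phi> (1 / \<alpha> n)" for n
    using \<alpha>(1)[of n] by (intro index_conjugate_nonneg) simp
  have R_pos: "0 < R n" if "n \<ge> 1" for n
    unfolding R_eq[OF that] using conj0[of n] t0[of n] \<sigma> that by (intro add_nonneg_pos) auto
  have R_step: "R n \<le> 2 * R (Suc n)" if "n \<ge> 1" for n
  proof -
    have "\<sigma>\<^sup>2 / real n \<le> 2 * (\<sigma>\<^sup>2 / real (Suc n))"
    proof -
      have "real (Suc n) * \<sigma>\<^sup>2 \<le> (2 * real n) * \<sigma>\<^sup>2"
        using that by (intro mult_right_mono) auto
      then show ?thesis using that by (simp add: field_simps)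
    qed
    then have "\<sigma>\<^sup>2 / real n * t (Suc n) \<le> 2 * (\<sigma>\<^sup>2 / real (Suc n)) * t (Suc n)"
      using t0[of "Suc n"] by (intro mult_right_mono) auto
    then show ?thesis
      using R_le[OF t0, of n "Suc n"] R_eq[of "Suc n"] conj0[of "Suc n"]
      by (simp add: Psi_eq_index_conjugate tpow del: of_nat_Suc)
  qed
  \<comment> \<open>Otherwise \<open>Psi\<close> would vanish and the objective would be linear in
    \<open>t\<close>, without a minimiser on the open half-line.\<close>
  have \<phi>1: "0 < \<phi> 1"
  proof (rule ccontr)
    assume "\<not> ?thesis"
    then have \<phi>0: "\<phi> \<tau> \<le> 0" if "0 \<le> \<tau>" for \<tau>
      using index_function_affine_bound[OF \<phi>, of 1 \<tau>] index_function_nonneg[OF \<phi>(1), of 1] that by simp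
    have "Psi \<theta> \<phi> s \<le> 0" if "0 < s" for s
      unfolding Psi_eq_index_conjugate index_conjugate_eq
    proof (rule cSUP_least)
      fix \<tau> :: real assume "\<tau> \<in> {0..}"
      then have "\<phi> \<tau> \<le> 0" "0 \<le> s powr (1 / (2 - \<theta>)) * \<tau>" using \<phi>0 by auto
      then show "\<phi> \<tau> - s powr (1 / (2 - \<theta>)) * \<tau> \<le> 0" by linarith
    qed simp
    then have "Psi \<theta> \<phi> s = 0" if "0 < s" for s using Psi_nonneg that by (simp add: order_antisym)
    then have "\<sigma>\<^sup>2 * t 1 \<le> \<sigma>\<^sup>2 * (t 1 / 2)" using min[of 1 "t 1 / 2"] t0[of 1] by simp
    then show False using \<sigma> t0[of 1] by (simp add: mult_le_cancel_left)
  qed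
  have power_part: "\<alpha> n powr (\<theta> - 1) / real n / \<alpha> n \<le> 1 / \<sigma>\<^sup>2 * R n" if "n \<ge> 1" for n
  proof -
    have "\<alpha> n powr (\<theta> - 1) / real n / \<alpha> n = \<alpha> n powr (\<theta> - 1) / \<alpha> n / real n"
      by (simp only: divide_divide_eq_left mult.commute)
    then have "\<alpha> n powr (\<theta> - 1) / real n / \<alpha> n = t n / real n"
      using powr_pred_divide[OF \<alpha>(1)[of n]] by (simp only: t_def)
    also have "\<dots> = 1 / \<sigma>\<^sup>2 * (\<sigma>\<^sup>2 / real n * t n)" using \<sigma> by simp
    also have "\<dots> \<le> 1 / \<sigma>\<^sup>2 * R n" using R_eq[OF that] conj0[of n] by (intro mult_left_mono) auto
    finally show ?thesis .
  qed
  \<comment> \<open>Solves \<open>1 / 2 + q - 1 = - (q / \<epsilon>)\<close>, the balance of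
    exponents when \<open>\<alpha> n\<close> is not below \<open>n powr (- q)\<close>.\<close>
  define q where "q = \<epsilon> / (2 * (1 + \<epsilon>))"
  have q: "0 < q" using \<epsilon> by (simp add: q_def)
  have "0 < q * (1 - \<theta>)" using q \<theta> by simp
  then obtain B1 where B1: "0 \<le> B1" "\<And>n. n \<ge> 1 \<Longrightarrow> ln (real n + 1) \<le> B1 * real n powr (q * (1 - \<theta>))"
    using ln_Suc_le_powr by blast
  obtain B2 where B2: "0 \<le> B2" "\<And>n. n \<ge> 1 \<Longrightarrow> ln (real n + 1) \<le> B2 * real n powr (1 / 2)"
    using ln_Suc_le_powr[of "1 / 2"] by auto
  define I where "I = index_conjugate \<phi> 1"
  have I: "0 < I" unfolding I_def by (rule index_conjugate_pos[OF \<phi>1])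
  \<comment> \<open>If \<open>\<alpha> n\<close> is below \<open>n powr (- q)\<close>, the spare
    factor \<open>\<alpha> n powr (1 - \<theta>)\<close> kills the logarithm, and the noise part of
    \<open>R n\<close> dominates. Otherwise the conjugate at \<open>1 / \<alpha> n\<close> is at
    least \<open>I * n powr (- (q / \<epsilon>))\<close>, which matches the decay of the logarithmic
    term.\<close>
  have log_part: "ln (real n + 1) / real n / \<alpha> n \<le> (B1 / \<sigma>\<^sup>2 + B2 / I) * R n" if n: "n \<ge> 1" for n
  proof (cases "\<alpha> n < real n powr (- q)")
    case True
    have "ln (real n + 1) * \<alpha> n powr (1 - \<theta>)
      \<le> B1 * real n powr (q * (1 - \<theta>)) * (real n powr (- q)) powr (1 - \<theta>)"
      using True \<theta> \<alpha>(1)[of n] B1 n by (intro mult_mono powr_mono2) auto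
    also have "\<dots> = B1 * (real n powr (q * (1 - \<theta>)) * real n powr (- q * (1 - \<theta>)))"
      by (simp only: powr_powr mult.assoc)
    also have "\<dots> = B1" using n by (simp add: powr_add[symmetric])
    finally have b: "ln (real n + 1) * \<alpha> n powr (1 - \<theta>) \<le> B1" .
    have "ln (real n + 1) / real n / \<alpha> n
      = ln (real n + 1) * \<alpha> n powr (1 - \<theta>) * (\<alpha> n powr (\<theta> - 1) / real n / \<alpha> n)"
      using powr_add[of "\<alpha> n" "1 - \<theta>" "\<theta> - 1"] \<alpha>(1)[of n] by simp
    also have "\<dots> \<le> B1 * (1 / \<sigma>\<^sup>2 * R n)"
      using b B1 \<alpha>(1)[of n] power_part[OF n] by (intro mult_mono) auto
    also have "\<dots> \<le> (B1 / \<sigma>\<^sup>2 + B2 / I) * R n"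
      using B2(1) I R_pos[OF n] by (simp add: distrib_right)
    finally show ?thesis .
  next
    case False
    have "I \<le> (1 / \<alpha> n) powr (1 / \<epsilon>) * index_conjugate \<phi> (1 / \<alpha> n)"
      using index_conjugate_scaling[of "1 / \<alpha> n" "1 / \<alpha> n"] \<alpha>(1,2)[of n] by (simp add: I_def)
    also have "\<dots> \<le> (real n powr q) powr (1 / \<epsilon>) * R n"
    proof (intro mult_mono powr_mono2)
      show "1 / \<alpha> n \<le> real n powr q"
        using False \<alpha>(1)[of n] n by (simp add: powr_minus field_simps)
      show "index_conjugate \<phi> (1 / \<alpha> n) \<le> R n" using R_eq[OF n] t0[of n] by simp
    qed (use \<epsilon> \<alpha>(1)[of n] conj0 in auto)
    finally have I_le: "I \<le> real n powr (q / \<epsilon>) * R n" by (simp add: powr_powr)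
    have "ln (real n + 1) / real n / \<alpha> n = ln (real n + 1) * (1 / \<alpha> n) / real n" by simp
    also have "\<dots> \<le> (B2 * real n powr (1 / 2)) * real n powr q / real n"
      using False \<alpha>(1)[of n] n B2
      by (intro divide_right_mono mult_mono) (auto simp: powr_minus field_simps)
    also have "\<dots> = B2 * real n powr (1 / 2 + q - 1)"
    proof -
      have "real n powr (1 / 2 + q - 1) = real n powr (1 / 2) * real n powr q / real n"
        using n by (simp only: powr_diff powr_add) simp
      then show ?thesis by (simp only: mult.assoc times_divide_eq_right)
    qed
    also have "1 / 2 + q - 1 = - (q / \<epsilon>)"
    proof -
      have "q / \<epsilon> = 1 / (2 * (1 + \<epsilon>))" using \<epsilon> by (simp add: q_def)
      moreover have "q + 1 / (2 * (1 + \<epsilon>)) = (1 + \<epsilon>) / (2 * (1 + \<epsilon>))"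
        by (simp only: q_def add_divide_distrib add.commute)
      moreover have "(1 + \<epsilon>) / (2 * (1 + \<epsilon>)) = 1 / 2"
        by (rule nonzero_divide_mult_cancel_right) (use \<epsilon> in simp)
      ultimately show ?thesis by linarith
    qed
    also have "B2 * real n powr (- (q / \<epsilon>)) \<le> B2 * (R n / I)"
      using I_le I n B2(1) by (intro mult_left_mono) (auto simp: powr_minus field_simps)
    also have "\<dots> \<le> (B1 / \<sigma>\<^sup>2 + B2 / I) * R n"
      using B1(1) R_pos[OF n] by (simp add: distrib_right)
    finally show ?thesis .
  qed
  define A where "A = (4 * C) powr (1 / \<epsilon>) + K * (1 / \<sigma>\<^sup>2 + (B1 / \<sigma>\<^sup>2 + B2 / I))"
  have A0: "0 \<le> A" using K B1(1) B2(1) I by (simp add: A_def)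
  have est': "3 / 4 * \<alpha> n * e n + d n / (8 * C) \<le> 2 * \<eta> * d (n - 1) + \<alpha> n * (A * R n)" if n: "n \<ge> 1" for n
  proof -
    \<comment> \<open>The slope is lowered by \<open>4 * C\<close> so that, multiplied by
      \<open>\<alpha> n\<close>, the linear part is exactly \<open>d n / (8 * C)\<close>, half of
      the residual term.\<close>
    have "\<phi> (d n / 2) \<le> index_conjugate \<phi> (1 / \<alpha> n / (4 * C)) + 1 / \<alpha> n / (4 * C) * (d n / 2)"
      using \<alpha>(1)[of n] C nonneg by (intro index_conjugate_upper) auto
    also have "index_conjugate \<phi> (1 / \<alpha> n / (4 * C)) \<le> (4 * C) powr (1 / \<epsilon>) * index_conjugate \<phi> (1 / \<alpha> n)"
      using \<alpha>(1)[of n] C by (intro index_conjugate_scaling) auto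
    also have "\<dots> \<le> (4 * C) powr (1 / \<epsilon>) * R n"
      using R_eq[OF n] t0[of n] by (intro mult_left_mono) auto
    finally have "\<alpha> n * \<phi> (d n / 2)
        \<le> \<alpha> n * ((4 * C) powr (1 / \<epsilon>) * R n + 1 / \<alpha> n / (4 * C) * (d n / 2))"
      using \<alpha>(1)[of n] by (intro mult_left_mono) auto
    also have "\<dots> = \<alpha> n * ((4 * C) powr (1 / \<epsilon>) * R n) + d n / (8 * C)"
      using \<alpha>(1)[of n] C by (simp add: distrib_left)
    finally have ph: "\<alpha> n * \<phi> (d n / 2) \<le> \<alpha> n * ((4 * C) powr (1 / \<epsilon>) * R n) + d n / (8 * C)" .
    have "(\<alpha> n powr (\<theta> - 1) / real n + ln (real n + 1) / real n) / \<alpha> n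
        \<le> 1 / \<sigma>\<^sup>2 * R n + (B1 / \<sigma>\<^sup>2 + B2 / I) * R n"
      using power_part[OF n] log_part[OF n] by (simp only: add_divide_distrib)
    then have "\<alpha> n powr (\<theta> - 1) / real n + ln (real n + 1) / real n
        \<le> \<alpha> n * ((1 / \<sigma>\<^sup>2 + (B1 / \<sigma>\<^sup>2 + B2 / I)) * R n)"
      using \<alpha>(1)[of n] by (simp only: pos_divide_le_eq) (simp add: algebra_simps)
    then have "K * (\<alpha> n powr (\<theta> - 1) / real n + ln (real n + 1) / real n)
        \<le> K * (\<alpha> n * ((1 / \<sigma>\<^sup>2 + (B1 / \<sigma>\<^sup>2 + B2 / I)) * R n))"
      using K by (rule mult_left_mono)
    moreover have "\<alpha> n * (A * R n) = \<alpha> n * ((4 * C) powr (1 / \<epsilon>) * R n)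
        + K * (\<alpha> n * ((1 / \<sigma>\<^sup>2 + (B1 / \<sigma>\<^sup>2 + B2 / I)) * R n))"
      by (simp add: A_def algebra_simps)
    moreover have "d n / (4 * C) = d n / (8 * C) + d n / (8 * C)" using C by simp
    ultimately show ?thesis using est[OF n] ph by linarith
  qed
  define \<delta> where "\<delta> n = d n / \<alpha> n" for n
  have \<delta>0: "0 \<le> \<delta> n" for n using nonneg \<alpha>(1)[of n] by (simp add: \<delta>_def)
  have step: "\<delta> (Suc n) \<le> 1 / 4 * \<delta> n + 8 * C * A * R (Suc n)"
    "e (Suc n) \<le> 4 / 3 * (2 * \<eta> * Cd * \<delta> n + A * R (Suc n))" for n
  proof -
    have "3 / 4 * \<alpha> (Suc n) * e (Suc n) + d (Suc n) / (8 * C) \<le> 2 * \<eta> * d n + \<alpha> (Suc n) * (A * R (Suc n))"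
      using est'[of "Suc n"] by simp
    note s = step_divided_by_parameter[OF \<alpha>(1) \<alpha>(1) \<alpha>(3) \<eta>(1) nonneg(1) nonneg(1) nonneg(2) C this]
    have "16 * C * \<eta> * Cd \<le> 1 / 4" using \<eta> C Cd by (simp add: field_simps)
    then have "16 * C * \<eta> * Cd * \<delta> n \<le> 1 / 4 * \<delta> n" using \<delta>0 by (rule mult_right_mono)
    then show "\<delta> (Suc n) \<le> 1 / 4 * \<delta> n + 8 * C * A * R (Suc n)"
      using s(1) by (simp add: \<delta>_def)
    show "e (Suc n) \<le> 4 / 3 * (2 * \<eta> * Cd * \<delta> n + A * R (Suc n))"
      using s(2) by (simp add: \<delta>_def)
  qed
  \<comment> \<open>The first summand starts the induction. In its step
    \<open>R n \<le> 2 * R (Suc n)\<close> turns the contraction factor 1/4 into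
    \<open>M / 2\<close>, and the second summand makes \<open>8 * C * A\<close> at most the other
    half.\<close>
  define M where "M = \<delta> 1 / R 1 + 16 * C * A"
  have M0: "0 \<le> M" using \<delta>0 R_pos[of 1] C A0 by (simp add: M_def)
  have \<delta>_le: "\<delta> n \<le> M * R n" if "n \<ge> 1" for n
    using that
  proof (induction n rule: dec_induct)
    case base
    have "\<delta> 1 / R 1 * R 1 \<le> M * R 1"
      using C A0 R_pos[of 1] by (intro mult_right_mono) (auto simp: M_def)
    then show ?case using R_pos[of 1] by simp
  next
    case (step n)
    have "\<delta> (Suc n) \<le> 1 / 4 * \<delta> n + 8 * C * A * R (Suc n)" by (rule \<open>\<delta> (Suc n) \<le> _\<close> step)
    also have "\<dots> \<le> 1 / 4 * (M * (2 * R (Suc n))) + 8 * C * A * R (Suc n)"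
      using step.IH mult_left_mono[OF R_step[OF step.hyps(1)] M0] by simp
    also have "8 * C * A * R (Suc n) \<le> M / 2 * R (Suc n)"
      using R_pos[of "Suc n"] R_pos[of 1] \<delta>0[of 1] by (intro mult_right_mono) (auto simp: M_def)
    finally show ?case by simp
  qed
  \<comment> \<open>The error at \<open>n\<close> is controlled by the residual at
    \<open>n - 1\<close>, whose bound starts at 1; hence \<open>n \<ge> 2\<close>.\<close>
  have "norm (e n) \<le> 4 / 3 * (2 * \<eta> * Cd * (2 * M) + A) * norm (R n)" if n: "n \<ge> 2" for n
  proof -
    obtain m where m: "n = Suc m" "m \<ge> 1" using n by (cases n) auto
    have "\<delta> m \<le> M * (2 * R n)"
      using \<delta>_le[OF m(2)] mult_left_mono[OF R_step[OF m(2)] M0] m(1) by simp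
    then have "4 / 3 * (2 * \<eta> * Cd * \<delta> m + A * R n) \<le> 4 / 3 * (2 * \<eta> * Cd * (M * (2 * R n)) + A * R n)"
      using \<eta>(1) Cd by (intro mult_left_mono add_right_mono) auto
    then have "e n \<le> 4 / 3 * (2 * \<eta> * Cd * (M * (2 * R n)) + A * R n)"
      using step(2)[of m] unfolding m(1)[symmetric] by (rule order_trans[rotated])
    also have "\<dots> = 4 / 3 * (2 * \<eta> * Cd * (2 * M) + A) * R n" by (simp add: algebra_simps)
    finally show ?thesis using nonneg(2)[of n] R_pos[of n] n by simp
  qed
  then have "e \<in> O(R)"
    by (intro bigoI[of _ "4 / 3 * (2 * \<eta> * Cd * (2 * M) + A)"]) (auto simp: eventually_sequentially)
  then show ?thesis by (simp add: R_def[abs_def])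
qed

end

theorem theorem3p2:
  fixes C\<^sub>t\<^sub>c C\<^sub>d\<^sub>e\<^sub>c \<theta> C\<^sub>\<theta> :: real
  assumes "1 \<le> C\<^sub>t\<^sub>c" and "0 < \<theta>" and "\<theta> < 1" and "1 \<le> C\<^sub>\<theta>"
  shows "\<exists>\<eta>\<^sub>0>0. \<exists>\<delta>>0.
    \<forall>(M :: 'w measure)
     (j :: 'v::{real_inner,complete_space} \<Rightarrow> 'y::{real_inner,complete_space})
     (\<xi> :: nat \<Rightarrow> 'y \<Rightarrow> 'w \<Rightarrow> real) (\<sigma> :: real)
     (D :: 'x::{real_inner,complete_space} set) (F :: 'x \<Rightarrow> 'y) (F' :: 'x \<Rightarrow> 'x \<Rightarrow> 'y)
     (u\<^sub>d :: 'x) (u\<^sub>0 :: 'x) (u :: nat \<Rightarrow> 'w \<Rightarrow> 'x)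
     (\<phi> :: real \<Rightarrow> real) (\<eta> :: real) (\<alpha> :: nat \<Rightarrow> real).
      prob_space M \<and> gelfand_embedding j \<and> hilbert_schmidt j \<and> noise_sequence M j \<xi> \<and> 0 < \<sigma> \<and>
      u\<^sub>d \<in> D \<and> u\<^sub>0 \<in> D \<and> continuous_on D F \<and> derivative_on D F F' \<and>
      index_function \<phi> \<and> concave_on {0..} \<phi> \<and> variational_source_condition D F u\<^sub>d u\<^sub>0 \<phi> \<and>
      0 < \<eta> \<and> \<eta> \<le> \<eta>\<^sub>0 \<and> tangential_cone_condition D F F' (F u\<^sub>d) C\<^sub>t\<^sub>c \<eta> \<and>
      norm (F u\<^sub>0 - F u\<^sub>d) \<le> \<delta> \<and>
      (\<forall>n. 0 < \<alpha> n) \<and>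
      (AE \<omega> in M. dynamic_irgn_iterates D F F' u\<^sub>0 (averaged_data (F u\<^sub>d) \<sigma> \<xi> \<omega>) \<alpha> (\<lambda>n. u n \<omega>)) \<and>
      (AE \<omega> in M. V_smoothing j F' u\<^sub>d \<theta> C\<^sub>\<theta> (\<lambda>n. u n \<omega>))
      \<longrightarrow>
      (decseq \<alpha> \<and> \<alpha> \<longlonglongrightarrow> 0 \<and>
       incseq (\<lambda>n. real n * \<alpha> n powr (2 - \<theta>)) \<and>
       filterlim (\<lambda>n. real n * \<alpha> n powr (2 - \<theta>)) at_top sequentially
       \<longrightarrow>
       (AE \<omega> in M. (\<lambda>n. (norm (u n \<omega> - u\<^sub>d))\<^sup>2) \<longlonglongrightarrow> 0))
      \<and>
      (saturation_condition \<phi> \<and> parameter_condition C\<^sub>d\<^sub>e\<^sub>c \<alpha> \<and>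
       (\<forall>n\<ge>1. is_arg_min (\<lambda>t. Psi \<theta> \<phi> t + \<sigma>\<^sup>2 / real n * t) (\<lambda>t. 0 < t)
                 (1 / \<alpha> n powr (2 - \<theta>)))
       \<longrightarrow>
       (AE \<omega> in M. (\<lambda>n. (norm (u n \<omega> - u\<^sub>d))\<^sup>2) \<in> O(\<lambda>n. R_rate \<theta> \<phi> (\<sigma>\<^sup>2 / real n))))"
proof -
  \<comment> \<open>\<open>C\<^sub>d\<^sub>e\<^sub>c\<close> is an arbitrary real; the maximum
    preserves the ratio bound and keeps \<open>\<eta>\<^sub>0\<close> positive.\<close>
  define Cd where "Cd = max 1 C\<^sub>d\<^sub>e\<^sub>c"
  have Cd: "1 \<le> Cd" by (simp add: Cd_def)
  define \<eta>\<^sub>0 where "\<eta>\<^sub>0 = 1 / (64 * C\<^sub>t\<^sub>c * Cd)"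
  have \<eta>\<^sub>0: "0 < \<eta>\<^sub>0" "\<eta>\<^sub>0 \<le> 1 / (64 * C\<^sub>t\<^sub>c)"
    using assms(1) Cd by (auto simp: \<eta>\<^sub>0_def intro!: divide_left_mono)
  show ?thesis
  proof (intro exI[of _ \<eta>\<^sub>0] exI[of _ "1::real"] conjI allI impI \<eta>\<^sub>0(1) zero_less_one; elim conjE)
    fix M :: "'w measure" and j :: "'v \<Rightarrow> 'y" and \<xi> :: "nat \<Rightarrow> 'y \<Rightarrow> 'w \<Rightarrow> real" and \<sigma> :: real
      and D :: "'x set" and F :: "'x \<Rightarrow> 'y" and F' :: "'x \<Rightarrow> 'x \<Rightarrow> 'y" and u\<^sub>d u\<^sub>0 :: 'x
      and u :: "nat \<Rightarrow> 'w \<Rightarrow> 'x" and \<phi> :: "real \<Rightarrow> real" and \<eta> :: real and \<alpha> :: "nat \<Rightarrow> real"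
    assume M: "prob_space M" and j: "gelfand_embedding j" "hilbert_schmidt j"
      and noise: "noise_sequence M j \<xi>" and \<sigma>: "0 < \<sigma>"
      and D: "u\<^sub>d \<in> D" "u\<^sub>0 \<in> D" and deriv: "derivative_on D F F'"
      and \<phi>: "index_function \<phi>" "concave_on {0..} \<phi>"
      and vsc: "variational_source_condition D F u\<^sub>d u\<^sub>0 \<phi>"
      and \<eta>: "0 < \<eta>" "\<eta> \<le> \<eta>\<^sub>0" and tcc: "tangential_cone_condition D F F' (F u\<^sub>d) C\<^sub>t\<^sub>c \<eta>"
      and \<alpha>: "\<forall>n. 0 < \<alpha> n"
      and it: "AE \<omega> in M. dynamic_irgn_iterates D F F' u\<^sub>0 (averaged_data (F u\<^sub>d) \<sigma> \<xi> \<omega>) \<alpha> (\<lambda>n. u n \<omega>)"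
      and sm: "AE \<omega> in M. V_smoothing j F' u\<^sub>d \<theta> C\<^sub>\<theta> (\<lambda>n. u n \<omega>)"
    interpret prob_space M by (rule M)
    have \<alpha>0: "0 < \<alpha> n" for n using \<alpha> by simp
    define e where "e \<omega> n = (norm (u n \<omega> - u\<^sub>d))\<^sup>2" for \<omega> n
    define d where "d \<omega> n = (norm (F (u n \<omega>) - F u\<^sub>d))\<^sup>2" for \<omega> n
    have nonneg: "0 \<le> d \<omega> n" "0 \<le> e \<omega> n" for \<omega> n by (simp_all add: d_def e_def)
    have lin: "AE \<omega> in M. \<forall>i\<ge>1. linear (\<lambda>g. \<xi> i g \<omega>)"
      using noise_sequence_AE_linear[OF noise] by eventually_elim auto
    have inj: "inj j" using j(1) by (simp add: gelfand_embedding_def)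
    \<comment> \<open>After this point everything is pathwise. \<open>K\<close> varies with
      \<open>\<omega>\<close>, so the constant in the rate is random, whereas
      \<open>\<eta>\<^sub>0\<close> depends only on \<open>C\<^sub>t\<^sub>c\<close> and
      \<open>C\<^sub>d\<^sub>e\<^sub>c\<close>.\<close>
    have est: "AE \<omega> in M. \<exists>K\<ge>0. \<forall>n\<ge>1. 3 / 4 * \<alpha> n * e \<omega> n + d \<omega> n / (4 * C\<^sub>t\<^sub>c)
      \<le> 2 * \<eta> * d \<omega> (n - 1) + \<alpha> n * \<phi> (d \<omega> n / 2)
        + K * (\<alpha> n powr (\<theta> - 1) / real n + ln (real n + 1) / real n)"
      using it sm lin noise_functional_bound[OF noise inj j(2)]
    proof eventually_elim
      case (elim \<omega>)
      from elim(4) obtain N where N: "\<forall>n\<ge>1. \<forall>v. \<bar>\<Sum>i=1..n. \<xi> i (j v) \<omega>\<bar>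
          \<le> N * sqrt n * (norm v + sqrt (ln (real n + 1)) * norm (j v))" ..
      show ?case
        unfolding e_def d_def
        by (rule irgn_path_estimate[OF assms(1-4) \<eta>(1) \<sigma> D deriv vsc tcc \<alpha>0 elim(1,2) _ N])
          (use elim(3) in blast)
    qed
    {
      assume a: "\<alpha> \<longlonglongrightarrow> 0" "incseq (\<lambda>n. real n * \<alpha> n powr (2 - \<theta>))"
        "filterlim (\<lambda>n. real n * \<alpha> n powr (2 - \<theta>)) at_top sequentially"
      have "\<eta> \<le> 1 / (64 * C\<^sub>t\<^sub>c)" using \<eta>(2) \<eta>\<^sub>0(2) by simp
      show "AE \<omega> in M. (\<lambda>n. (norm (u n \<omega> - u\<^sub>d))\<^sup>2) \<longlonglongrightarrow> 0"
        using est
      proof eventually_elim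
        case (elim \<omega>)
        then obtain K where "\<And>n. n \<ge> 1 \<Longrightarrow> 3 / 4 * \<alpha> n * e \<omega> n + d \<omega> n / (4 * C\<^sub>t\<^sub>c)
          \<le> 2 * \<eta> * d \<omega> (n - 1) + \<alpha> n * \<phi> (d \<omega> n / 2)
            + K * (\<alpha> n powr (\<theta> - 1) / real n + ln (real n + 1) / real n)" by blast
        from irgn_error_tendsto_zero[OF assms(1-3) less_imp_le[OF \<eta>(1)] \<open>\<eta> \<le> 1 / (64 * C\<^sub>t\<^sub>c)\<close>
            \<alpha>0 a \<phi> nonneg this]
        show ?case by (simp add: e_def[abs_def])
      qed
    next
      assume sat: "saturation_condition \<phi>" and par: "parameter_condition C\<^sub>d\<^sub>e\<^sub>c \<alpha>"
        and opt: "\<forall>n\<ge>1. is_arg_min (\<lambda>t. Psi \<theta> \<phi> t + \<sigma>\<^sup>2 / real n * t) (\<lambda>t. 0 < t)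
          (1 / \<alpha> n powr (2 - \<theta>))"
      obtain \<epsilon> where \<epsilon>: "0 < \<epsilon>" "concave_on {0..} (\<lambda>\<tau>. \<phi> \<tau> powr (1 + \<epsilon>))"
        using sat by (auto simp: saturation_condition_def)
      have "\<alpha> n \<le> 1" for n
        using par decseqD[of \<alpha> 0 n] by (auto simp: parameter_condition_def)
      moreover have "\<alpha> n / \<alpha> (Suc n) \<le> Cd" for n
        using par by (auto simp: parameter_condition_def Cd_def le_max_iff_disj)
      ultimately have par': "\<And>n. \<alpha> n \<le> 1" "\<And>n. \<alpha> n / \<alpha> (Suc n) \<le> Cd" by blast+
      show "AE \<omega> in M. (\<lambda>n. (norm (u n \<omega> - u\<^sub>d))\<^sup>2) \<in> O(\<lambda>n. R_rate \<theta> \<phi> (\<sigma>\<^sup>2 / real n))"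
        using est
      proof eventually_elim
        case (elim \<omega>)
        then obtain K where "0 \<le> K" "\<And>n. n \<ge> 1 \<Longrightarrow> 3 / 4 * \<alpha> n * e \<omega> n + d \<omega> n / (4 * C\<^sub>t\<^sub>c)
          \<le> 2 * \<eta> * d \<omega> (n - 1) + \<alpha> n * \<phi> (d \<omega> n / 2)
            + K * (\<alpha> n powr (\<theta> - 1) / real n + ln (real n + 1) / real n)" by blast
        from irgn_error_rate[OF \<phi> \<epsilon> assms(1-3) \<sigma> Cd less_imp_le[OF \<eta>(1)] \<eta>(2)[unfolded \<eta>\<^sub>0_def]
            \<alpha>0 par' opt nonneg this]
        show ?case by (simp add: e_def[abs_def])
      qed
    }
  qed
qed

end
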